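(* Let $A=\bigoplus_{i\ge0}A_i$ be a connected $\mathbb{N}$-graded $k$-algebra over a field $k$ (thus $A_0=k$). Let $P$ be a right $A$-module that is both graded and projective. Then $P$ is a graded-free $A$-module, in the sense that $P$ has a free basis of homogeneous elements.
   Context: "Graded" means $\mathbb{Z}$-graded: $P=\bigoplus_{i\in\mathbb{Z}}P_i$ with $P_iA_j\subseteq P_{i+j}$. Projective means projective as an (ungraded) right $A$-module. $P$ is not assumed finitely generated and $A$ is not assumed commutative or noetherian. *)

theory Defs
  imports "HOL-Algebra.Module"
begin

text \<open>
  The locale \<^locale>\<open>module\<close> requires a commutative ring of scalars, so right modules over
  an arbitrary unital ring are set up here. As in \<open>HOL-Algebra.Module\<close>, the fields \<open>mult\<close>
  and \<open>one\<close> of the record carry no meaning.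
\<close>

record ('a, 'p) rmodule = "'p ring" +
  ract :: "'p \<Rightarrow> 'a \<Rightarrow> 'p"  (infixl \<open>\<cdot>\<index>\<close> 70)

locale right_module = A?: ring A + P?: abelian_group P
  for A (structure) and P (structure) +
  assumes ract_closed [simp, intro]:
      "\<lbrakk>x \<in> carrier P; a \<in> carrier A\<rbrakk> \<Longrightarrow> x \<cdot>\<^bsub>P\<^esub> a \<in> carrier P"
    and ract_l_distr:
      "\<lbrakk>x \<in> carrier P; y \<in> carrier P; a \<in> carrier A\<rbrakk> \<Longrightarrow>
        (x \<oplus>\<^bsub>P\<^esub> y) \<cdot>\<^bsub>P\<^esub> a = x \<cdot>\<^bsub>P\<^esub> a \<oplus>\<^bsub>P\<^esub> y \<cdot>\<^bsub>P\<^esub> a"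
    and ract_r_distr:
      "\<lbrakk>x \<in> carrier P; a \<in> carrier A; b \<in> carrier A\<rbrakk> \<Longrightarrow>
        x \<cdot>\<^bsub>P\<^esub> (a \<oplus>\<^bsub>A\<^esub> b) = x \<cdot>\<^bsub>P\<^esub> a \<oplus>\<^bsub>P\<^esub> x \<cdot>\<^bsub>P\<^esub> b"
    and ract_assoc:
      "\<lbrakk>x \<in> carrier P; a \<in> carrier A; b \<in> carrier A\<rbrakk> \<Longrightarrow>
        x \<cdot>\<^bsub>P\<^esub> (a \<otimes>\<^bsub>A\<^esub> b) = (x \<cdot>\<^bsub>P\<^esub> a) \<cdot>\<^bsub>P\<^esub> b"
    and ract_one [simp]:
      "x \<in> carrier P \<Longrightarrow> x \<cdot>\<^bsub>P\<^esub> \<one>\<^bsub>A\<^esub> = x"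

definition rmod_hom ::
  "('a, 'r) ring_scheme \<Rightarrow> ('a, 'm, 's) rmodule_scheme \<Rightarrow> ('a, 'n, 't) rmodule_scheme \<Rightarrow> ('m \<Rightarrow> 'n) set"
  where "rmod_hom A M N =
    {f \<in> carrier M \<rightarrow> carrier N.
      (\<forall>x\<in>carrier M. \<forall>y\<in>carrier M. f (x \<oplus>\<^bsub>M\<^esub> y) = f x \<oplus>\<^bsub>N\<^esub> f y) \<and>
      (\<forall>x\<in>carrier M. \<forall>a\<in>carrier A. f (x \<cdot>\<^bsub>M\<^esub> a) = f x \<cdot>\<^bsub>N\<^esub> a)}"

text \<open>
  Projectivity is the lifting property against surjections \<open>g : M \<rightarrow> N\<close>. A definition in HOL
  cannot quantify over types, so the types on which \<open>M\<close> and \<open>N\<close> live have to be fixed. The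
  types chosen below are large enough to accommodate the free module on the underlying set
  of \<open>P\<close> and its canonical surjection onto \<open>P\<close>; the lemma \<open>projective_lifting\<close> shows that the
  lifting property then holds against modules \<open>M\<close> and \<open>N\<close> on arbitrary types.
\<close>

definition projective :: "('a, 'r) ring_scheme \<Rightarrow> ('a, 'p, 's) rmodule_scheme \<Rightarrow> bool"
  where "projective A P \<longleftrightarrow> right_module A P \<and>
    (\<forall>(M :: ('a, 'p \<Rightarrow> 'a) rmodule) (N :: ('a, 'p) rmodule).
      right_module A M \<longrightarrow> right_module A N \<longrightarrow>
      (\<forall>g\<in>rmod_hom A M N. g ` carrier M = carrier N \<longrightarrow>
        (\<forall>f\<in>rmod_hom A P N. \<exists>h\<in>rmod_hom A P M. \<forall>x\<in>carrier P. g (h x) = f x)))"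

definition free_basis :: "('a, 'r) ring_scheme \<Rightarrow> ('a, 'p, 's) rmodule_scheme \<Rightarrow> 'p set \<Rightarrow> bool"
  where "free_basis A P B \<longleftrightarrow> B \<subseteq> carrier P \<and>
    (\<forall>x\<in>carrier P. \<exists>!c. (\<forall>b\<in>B. c b \<in> carrier A) \<and> (\<forall>b. b \<notin> B \<longrightarrow> c b = \<zero>\<^bsub>A\<^esub>) \<and>
      finite {b. c b \<noteq> \<zero>\<^bsub>A\<^esub>} \<and> x = (\<Oplus>\<^bsub>P\<^esub>b\<in>{b. c b \<noteq> \<zero>\<^bsub>A\<^esub>}. b \<cdot>\<^bsub>P\<^esub> c b))"

definition internal_direct_sum :: "('a, 'r) ring_scheme \<Rightarrow> ('i \<Rightarrow> 'a set) \<Rightarrow> bool"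
  where "internal_direct_sum G D \<longleftrightarrow>
    (\<forall>i. subgroup (D i) (add_monoid G)) \<and>
    (\<forall>x\<in>carrier G. \<exists>!c. (\<forall>i. c i \<in> D i) \<and> finite {i. c i \<noteq> \<zero>\<^bsub>G\<^esub>} \<and>
      x = (\<Oplus>\<^bsub>G\<^esub>i\<in>{i. c i \<noteq> \<zero>\<^bsub>G\<^esub>}. c i))"

text \<open>
  The record type \<^typ>\<open>('k, 'a) module\<close> carries both the ring structure of an algebra and
  its scalar multiplication; \<^locale>\<open>algebra\<close> itself is restricted to commutative algebras.
  Bijectivity in \<open>connected\<close> says that the unit map identifies \<open>K\<close> with the component of
  degree 0; in particular the algebra is nonzero.
\<close>

locale connected_graded_algebra = K?: field K + A?: ring A + module K A
  for K :: "('k, 'r) ring_scheme" (structure) and A :: "('k, 'a, 's) module_scheme" (structure) +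
  fixes A_gr :: "nat \<Rightarrow> 'a set"
  assumes smult_mult_left:
      "\<lbrakk>c \<in> carrier K; x \<in> carrier A; y \<in> carrier A\<rbrakk> \<Longrightarrow>
        (c \<odot>\<^bsub>A\<^esub> x) \<otimes>\<^bsub>A\<^esub> y = c \<odot>\<^bsub>A\<^esub> (x \<otimes>\<^bsub>A\<^esub> y)"
    and smult_mult_right:
      "\<lbrakk>c \<in> carrier K; x \<in> carrier A; y \<in> carrier A\<rbrakk> \<Longrightarrow>
        x \<otimes>\<^bsub>A\<^esub> (c \<odot>\<^bsub>A\<^esub> y) = c \<odot>\<^bsub>A\<^esub> (x \<otimes>\<^bsub>A\<^esub> y)"
    and A_gr_submodule: "submodule (A_gr i) K A"
    and A_gr_direct_sum: "internal_direct_sum A A_gr"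
    and A_gr_mult: "\<lbrakk>x \<in> A_gr i; y \<in> A_gr j\<rbrakk> \<Longrightarrow> x \<otimes>\<^bsub>A\<^esub> y \<in> A_gr (i + j)"
    and connected: "bij_betw (\<lambda>c. c \<odot>\<^bsub>A\<^esub> \<one>\<^bsub>A\<^esub>) (carrier K) (A_gr 0)"

locale graded_right_module = right_module A P
  for A :: "('a, 'r) ring_scheme" (structure) and A_gr :: "nat \<Rightarrow> 'a set"
    and P :: "('a, 'p, 's) rmodule_scheme" (structure) +
  fixes P_gr :: "int \<Rightarrow> 'p set"
  assumes P_gr_direct_sum: "internal_direct_sum P P_gr"
    and P_gr_ract: "\<lbrakk>x \<in> P_gr i; a \<in> A_gr j\<rbrakk> \<Longrightarrow> x \<cdot>\<^bsub>P\<^esub> a \<in> P_gr (i + int j)"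

context right_module
begin

lemma ract_l_null [simp]: "a \<in> carrier A \<Longrightarrow> \<zero>\<^bsub>P\<^esub> \<cdot>\<^bsub>P\<^esub> a = \<zero>\<^bsub>P\<^esub>"
  using ract_l_distr[of "\<zero>\<^bsub>P\<^esub>" "\<zero>\<^bsub>P\<^esub>" a]
  by (metis P.add.l_cancel_one P.l_zero P.zero_closed ract_closed)

lemma ract_r_null [simp]: "x \<in> carrier P \<Longrightarrow> x \<cdot>\<^bsub>P\<^esub> \<zero>\<^bsub>A\<^esub> = \<zero>\<^bsub>P\<^esub>"
  using ract_r_distr[of x "\<zero>\<^bsub>A\<^esub>" "\<zero>\<^bsub>A\<^esub>"]
  by (metis A.l_zero A.zero_closed P.add.l_cancel_one ract_closed)

lemma finsum_ract:
  assumes "finite S" "\<And>i. i \<in> S \<Longrightarrow> m i \<in> carrier P" "a \<in> carrier A"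
  shows "(\<Oplus>\<^bsub>P\<^esub>i\<in>S. m i) \<cdot>\<^bsub>P\<^esub> a = (\<Oplus>\<^bsub>P\<^esub>i\<in>S. m i \<cdot>\<^bsub>P\<^esub> a)"
  using assms
  by (induction S rule: finite_induct) (auto simp: ract_l_distr Pi_iff)

end

lemma rmod_hom_closed: "f \<in> rmod_hom A M N \<Longrightarrow> x \<in> carrier M \<Longrightarrow> f x \<in> carrier N"
  by (auto simp: rmod_hom_def)

lemma rmod_hom_add:
  "f \<in> rmod_hom A M N \<Longrightarrow> x \<in> carrier M \<Longrightarrow> y \<in> carrier M \<Longrightarrow> f (x \<oplus>\<^bsub>M\<^esub> y) = f x \<oplus>\<^bsub>N\<^esub> f y"
  by (auto simp: rmod_hom_def)

lemma rmod_hom_ract: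
  "f \<in> rmod_hom A M N \<Longrightarrow> x \<in> carrier M \<Longrightarrow> a \<in> carrier A \<Longrightarrow> f (x \<cdot>\<^bsub>M\<^esub> a) = f x \<cdot>\<^bsub>N\<^esub> a"
  by (auto simp: rmod_hom_def)

lemma rmod_hom_comp:
  "f \<in> rmod_hom A L M \<Longrightarrow> g \<in> rmod_hom A M N \<Longrightarrow> (\<lambda>x. g (f x)) \<in> rmod_hom A L N"
  by (auto simp: rmod_hom_def Pi_iff)

lemma rmod_hom_zero:
  assumes "right_module A M" "right_module A N" "f \<in> rmod_hom A M N"
  shows "f \<zero>\<^bsub>M\<^esub> = \<zero>\<^bsub>N\<^esub>"
proof -
  interpret M: right_module A M by fact
  interpret N: right_module A N by fact
  show ?thesis
    using rmod_hom_add[OF assms(3), of "\<zero>\<^bsub>M\<^esub>" "\<zero>\<^bsub>M\<^esub>"] rmod_hom_closed[OF assms(3), of "\<zero>\<^bsub>M\<^esub>"]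
    by (metis M.P.l_zero M.P.zero_closed N.P.add.l_cancel_one)
qed

lemma rmod_hom_finsum:
  assumes "right_module A M" "right_module A N" "f \<in> rmod_hom A M N"
    and "finite S" "\<And>i. i \<in> S \<Longrightarrow> m i \<in> carrier M"
  shows "f (\<Oplus>\<^bsub>M\<^esub>i\<in>S. m i) = (\<Oplus>\<^bsub>N\<^esub>i\<in>S. f (m i))"
proof -
  interpret M: right_module A M by fact
  interpret N: right_module A N by fact
  show ?thesis
    using assms(4,5)
    by (induction S rule: finite_induct)
      (auto simp: rmod_hom_zero[OF assms(1-3)] rmod_hom_add[OF assms(3)]
        rmod_hom_closed[OF assms(3)] Pi_iff)
qed

definition free_rmodule :: "('a, 'r) ring_scheme \<Rightarrow> 'i set \<Rightarrow> ('a, 'i \<Rightarrow> 'a) rmodule"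
  where "free_rmodule A I =
    \<lparr>carrier = {c. (\<forall>i. c i \<in> carrier A) \<and> (\<forall>i. i \<notin> I \<longrightarrow> c i = \<zero>\<^bsub>A\<^esub>) \<and> finite {i. c i \<noteq> \<zero>\<^bsub>A\<^esub>}},
     mult = undefined, one = undefined,
     zero = (\<lambda>_. \<zero>\<^bsub>A\<^esub>), add = (\<lambda>c d i. c i \<oplus>\<^bsub>A\<^esub> d i),
     ract = (\<lambda>c a i. c i \<otimes>\<^bsub>A\<^esub> a)\<rparr>"

lemma right_module_free_rmodule:
  fixes I :: "'i set"
  assumes "ring A"
  shows "right_module A (free_rmodule A I)"
proof -
  interpret ring A by fact
  have supp: "finite {i. h i \<noteq> \<zero>\<^bsub>A\<^esub>}"
    if "finite {i. c i \<noteq> \<zero>\<^bsub>A\<^esub>}" "finite {i. d i \<noteq> \<zero>\<^bsub>A\<^esub>}"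
      "\<And>i. c i = \<zero>\<^bsub>A\<^esub> \<Longrightarrow> d i = \<zero>\<^bsub>A\<^esub> \<Longrightarrow> h i = \<zero>\<^bsub>A\<^esub>" for c d h :: "'i \<Rightarrow> 'a"
    by (rule finite_subset[OF _ finite_UnI[OF that(1,2)]]) (use that(3) in auto)
  show ?thesis
  proof (intro right_module.intro right_module_axioms.intro abelian_groupI assms)
    fix x y assume "x \<in> carrier (free_rmodule A I)" "y \<in> carrier (free_rmodule A I)"
    then show "x \<oplus>\<^bsub>free_rmodule A I\<^esub> y \<in> carrier (free_rmodule A I)"
      by (auto simp: free_rmodule_def intro: supp[of x y])
  next
    fix x assume x: "x \<in> carrier (free_rmodule A I)"
    show "\<exists>y\<in>carrier (free_rmodule A I). y \<oplus>\<^bsub>free_rmodule A I\<^esub> x = \<zero>\<^bsub>free_rmodule A I\<^esub>"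
      by (rule bexI[of _ "\<lambda>i. \<ominus>\<^bsub>A\<^esub> x i"])
        (use x in \<open>auto simp: free_rmodule_def l_neg intro: supp[of x x]\<close>)
  next
    fix x a assume "x \<in> carrier (free_rmodule A I)" "a \<in> carrier A"
    then show "x \<cdot>\<^bsub>free_rmodule A I\<^esub> a \<in> carrier (free_rmodule A I)"
      by (auto simp: free_rmodule_def intro: supp[of x x])
  qed (auto simp: free_rmodule_def a_ac l_distr r_distr m_assoc)
qed

definition lin_comb ::
  "('a, 'r) ring_scheme \<Rightarrow> ('a, 'm, 's) rmodule_scheme \<Rightarrow> ('i \<Rightarrow> 'm) \<Rightarrow> ('i \<Rightarrow> 'a) \<Rightarrow> 'm"
  where "lin_comb A M m c = (\<Oplus>\<^bsub>M\<^esub>i\<in>{i. c i \<noteq> \<zero>\<^bsub>A\<^esub>}. m i \<cdot>\<^bsub>M\<^esub> c i)"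

lemma lin_comb_superset:
  assumes "right_module A M" "m \<in> I \<rightarrow> carrier M" "c \<in> carrier (free_rmodule A I)"
    and S: "finite S" "{i. c i \<noteq> \<zero>\<^bsub>A\<^esub>} \<subseteq> S" "S \<subseteq> I"
  shows "lin_comb A M m c = (\<Oplus>\<^bsub>M\<^esub>i\<in>S. m i \<cdot>\<^bsub>M\<^esub> c i)"
proof -
  interpret M: right_module A M by fact
  show ?thesis
    unfolding lin_comb_def
    by (rule M.P.add.finprod_mono_neutral_cong_left)
      (use assms in \<open>auto simp: free_rmodule_def Pi_iff subset_iff\<close>)
qed

lemma lin_comb_hom:
  assumes M: "right_module A M" and m: "m \<in> I \<rightarrow> carrier M"
  shows "lin_comb A M m \<in> rmod_hom A (free_rmodule A I) M"
proof -
  interpret M: right_module A M by fact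
  let ?F = "free_rmodule A I"
  interpret F: right_module A ?F
    by (rule right_module_free_rmodule) (rule M.A.ring_axioms)
  have cl: "m i \<cdot>\<^bsub>M\<^esub> c i \<in> carrier M" if "c \<in> carrier ?F" "i \<in> I" for c i
    using that m by (auto simp: free_rmodule_def Pi_iff)
  have supp: "finite {i. c i \<noteq> \<zero>\<^bsub>A\<^esub>}" "{i. c i \<noteq> \<zero>\<^bsub>A\<^esub>} \<subseteq> I" if "c \<in> carrier ?F" for c
    using that by (auto simp: free_rmodule_def)
  show ?thesis
    unfolding rmod_hom_def
  proof (intro CollectI conjI ballI Pi_I)
    fix c assume "c \<in> carrier ?F"
    then show "lin_comb A M m c \<in> carrier M"
      unfolding lin_comb_def using cl supp(2) by (intro M.P.finsum_closed) blast
  next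
    fix c d assume c: "c \<in> carrier ?F" and d: "d \<in> carrier ?F"
    let ?S = "{i. c i \<noteq> \<zero>\<^bsub>A\<^esub>} \<union> {i. d i \<noteq> \<zero>\<^bsub>A\<^esub>}"
    have S: "finite ?S" "?S \<subseteq> I" using supp c d by auto
    have cd: "{i. (c \<oplus>\<^bsub>?F\<^esub> d) i \<noteq> \<zero>\<^bsub>A\<^esub>} \<subseteq> ?S" by (auto simp: free_rmodule_def)
    have "lin_comb A M m (c \<oplus>\<^bsub>?F\<^esub> d) = (\<Oplus>\<^bsub>M\<^esub>i\<in>?S. m i \<cdot>\<^bsub>M\<^esub> (c \<oplus>\<^bsub>?F\<^esub> d) i)"
      by (rule lin_comb_superset[OF M m F.P.a_closed[OF c d] S(1) cd S(2)])
    also have "\<dots> = (\<Oplus>\<^bsub>M\<^esub>i\<in>?S. m i \<cdot>\<^bsub>M\<^esub> c i \<oplus>\<^bsub>M\<^esub> m i \<cdot>\<^bsub>M\<^esub> d i)"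
      by (rule M.P.finsum_cong')
        (use c d m S(2) in \<open>auto simp: free_rmodule_def M.ract_r_distr Pi_iff subset_iff\<close>)
    also have "\<dots> = (\<Oplus>\<^bsub>M\<^esub>i\<in>?S. m i \<cdot>\<^bsub>M\<^esub> c i) \<oplus>\<^bsub>M\<^esub> (\<Oplus>\<^bsub>M\<^esub>i\<in>?S. m i \<cdot>\<^bsub>M\<^esub> d i)"
      by (rule M.P.finsum_addf) (use cl c d S in auto)
    also have "\<dots> = lin_comb A M m c \<oplus>\<^bsub>M\<^esub> lin_comb A M m d"
      using lin_comb_superset[OF M m c S(1) _ S(2)] lin_comb_superset[OF M m d S(1) _ S(2)]
      by auto
    finally show "lin_comb A M m (c \<oplus>\<^bsub>?F\<^esub> d) = lin_comb A M m c \<oplus>\<^bsub>M\<^esub> lin_comb A M m d" .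
  next
    fix c a assume c: "c \<in> carrier ?F" and a: "a \<in> carrier A"
    let ?S = "{i. c i \<noteq> \<zero>\<^bsub>A\<^esub>}"
    have S: "finite ?S" "?S \<subseteq> I" using supp c by auto
    have ca: "{i. (c \<cdot>\<^bsub>?F\<^esub> a) i \<noteq> \<zero>\<^bsub>A\<^esub>} \<subseteq> ?S" using a by (auto simp: free_rmodule_def)
    have "lin_comb A M m (c \<cdot>\<^bsub>?F\<^esub> a) = (\<Oplus>\<^bsub>M\<^esub>i\<in>?S. m i \<cdot>\<^bsub>M\<^esub> (c \<cdot>\<^bsub>?F\<^esub> a) i)"
      by (rule lin_comb_superset[OF M m F.ract_closed[OF c a] S(1) ca S(2)])
    also have "\<dots> = (\<Oplus>\<^bsub>M\<^esub>i\<in>?S. (m i \<cdot>\<^bsub>M\<^esub> c i) \<cdot>\<^bsub>M\<^esub> a)"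
      by (rule M.P.finsum_cong')
        (use c a m S(2) in \<open>auto simp: free_rmodule_def M.ract_assoc Pi_iff subset_iff\<close>)
    also have "\<dots> = lin_comb A M m c \<cdot>\<^bsub>M\<^esub> a"
      unfolding lin_comb_def by (rule M.finsum_ract[symmetric]) (use cl c a S in auto)
    finally show "lin_comb A M m (c \<cdot>\<^bsub>?F\<^esub> a) = lin_comb A M m c \<cdot>\<^bsub>M\<^esub> a" .
  qed
qed

lemma lin_comb_single:
  assumes "right_module A M" "m \<in> I \<rightarrow> carrier M" "i \<in> I"
  shows "\<exists>c\<in>carrier (free_rmodule A I). lin_comb A M m c = m i"
proof -
  interpret M: right_module A M by fact
  let ?c = "\<lambda>j. if j = i then \<one>\<^bsub>A\<^esub> else \<zero>\<^bsub>A\<^esub>"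
  have c: "?c \<in> carrier (free_rmodule A I)"
    using assms(3) by (auto simp: free_rmodule_def)
  have "lin_comb A M m ?c = (\<Oplus>\<^bsub>M\<^esub>j\<in>{i}. m j \<cdot>\<^bsub>M\<^esub> ?c j)"
    by (rule lin_comb_superset[OF assms(1,2) c]) (use assms(3) in auto)
  also have "\<dots> = m i" using assms(2,3) by (auto simp: Pi_iff)
  finally show ?thesis using c by blast
qed

text \<open>The term \<open>rmodule.truncate P\<close> forgets possible extension fields of the record \<open>P\<close>.\<close>

lemma truncate_sel [simp]:
  "carrier (rmodule.truncate P) = carrier P" "add (rmodule.truncate P) = add P"
  "zero (rmodule.truncate P) = zero P" "ract (rmodule.truncate P) = ract P"
  by (simp_all add: rmodule.truncate_def)

lemma right_module_truncate:
  assumes "right_module A P"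
  shows "right_module A (rmodule.truncate P)"
proof -
  interpret right_module A P by fact
  show ?thesis
    by (intro right_module.intro right_module_axioms.intro abelian_groupI A.ring_axioms)
      (auto simp: P.a_ac ract_l_distr ract_r_distr ract_assoc intro: P.l_neg)
qed

theorem projective_lifting:
  fixes M :: "('a, 'm, 's) rmodule_scheme" and N :: "('a, 'n, 't) rmodule_scheme"
  assumes P: "projective A P" and M: "right_module A M" and N: "right_module A N"
    and g: "g \<in> rmod_hom A M N" "g ` carrier M = carrier N"
    and f: "f \<in> rmod_hom A P N"
  shows "\<exists>h\<in>rmod_hom A P M. \<forall>x\<in>carrier P. g (h x) = f x"
proof -
  let ?F = "free_rmodule A (carrier P)" and ?P = "rmodule.truncate P"
  have PP: "right_module A P" using P by (simp add: projective_def)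
  interpret P: right_module A P by (rule PP)
  interpret M: right_module A M by fact
  have F: "right_module A ?F"
    by (rule right_module_free_rmodule) (rule P.A.ring_axioms)
  let ?p = "lin_comb A P (\<lambda>x. x)"
  have p: "?p \<in> rmod_hom A ?F P" by (rule lin_comb_hom[OF PP]) simp
  have "?p ` carrier ?F = carrier P"
    using rmod_hom_closed[OF p] lin_comb_single[OF PP, of "\<lambda>x. x" "carrier P"]
    by (fastforce simp: image_iff)
  moreover have "?p \<in> rmod_hom A ?F ?P" "(\<lambda>x. x) \<in> rmod_hom A P ?P"
    using p by (auto simp: rmod_hom_def)
  ultimately obtain s where s: "s \<in> rmod_hom A P ?F" "\<And>x. x \<in> carrier P \<Longrightarrow> ?p (s x) = x"
    using P F right_module_truncate[OF PP] unfolding projective_def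
    by (metis (no_types, lifting) truncate_sel(1))
  define m where "m = (\<lambda>x. SOME y. y \<in> carrier M \<and> g y = f x)"
  have m: "m x \<in> carrier M" "g (m x) = f x" if "x \<in> carrier P" for x
  proof -
    have "f x \<in> g ` carrier M" using rmod_hom_closed[OF f that] g(2) by simp
    then have "\<exists>y. y \<in> carrier M \<and> g y = f x" by auto
    from someI_ex[OF this] show "m x \<in> carrier M" "g (m x) = f x"
      unfolding m_def by auto
  qed
  have eq: "g (lin_comb A M m c) = f (?p c)" if c: "c \<in> carrier ?F" for c
  proof -
    have c': "finite {i. c i \<noteq> \<zero>\<^bsub>A\<^esub>}" "c i \<noteq> \<zero>\<^bsub>A\<^esub> \<Longrightarrow> i \<in> carrier P" "c i \<in> carrier A" for i
      using c by (auto simp: free_rmodule_def)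
    have "g (lin_comb A M m c) = (\<Oplus>\<^bsub>N\<^esub>i\<in>{i. c i \<noteq> \<zero>\<^bsub>A\<^esub>}. g (m i \<cdot>\<^bsub>M\<^esub> c i))"
      unfolding lin_comb_def by (rule rmod_hom_finsum[OF M N g(1)]) (use m c' in auto)
    also have "\<dots> = (\<Oplus>\<^bsub>N\<^esub>i\<in>{i. c i \<noteq> \<zero>\<^bsub>A\<^esub>}. f (i \<cdot>\<^bsub>P\<^esub> c i))"
    proof -
      interpret N: right_module A N by fact
      show ?thesis
        by (rule N.P.finsum_cong')
          (use m c' rmod_hom_closed[OF f] in
            \<open>auto simp: rmod_hom_ract[OF g(1)] rmod_hom_ract[OF f] Pi_iff\<close>)
    qed
    also have "\<dots> = f (?p c)"
      unfolding lin_comb_def by (rule rmod_hom_finsum[OF PP N f, symmetric]) (use c' in auto)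
    finally show ?thesis .
  qed
  have "(\<lambda>x. lin_comb A M m (s x)) \<in> rmod_hom A P M"
    by (rule rmod_hom_comp[OF s(1) lin_comb_hom[OF M]]) (use m in auto)
  then show ?thesis
    using eq s rmod_hom_closed[OF s(1)] by (intro bexI) auto
qed

end

theory Submission
  imports Defs "HOL-Library.Countable_Set"
begin

text \<open>
  Lifts to \<open>P\<close> of a basis of \<open>P / P A\<^sub>+\<close> need not generate \<open>P\<close> when the degrees are unbounded below,
  so the argument follows Kaplansky. Let \<open>I\<close> be the set of homogeneous elements of \<open>P\<close>. Taking
  degree-preserving parts of a splitting of the free module on \<open>I\<close> over \<open>P\<close> gives homogeneous
  coordinates \<open>\<Phi> x i\<close> with \<open>x = \<Sum>i. i \<cdot> \<Phi> x i\<close>. A set \<open>J \<subseteq> I\<close> is closed if the coordinates of its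
  elements are supported in \<open>J\<close>; the submodule \<open>U J\<close> of elements supported in \<open>J\<close> is then generated
  by \<open>J\<close>, and truncating coordinates to \<open>J\<close> is a retraction of \<open>P\<close> onto it. If \<open>J \<subseteq> J'\<close> are closed and
  all new elements have one degree, the quotient \<open>U J' / U J\<close> is free by linear algebra over \<open>A\<^sub>0\<close>;
  unions of chains extend this to degrees bounded below. If \<open>J' - J\<close> is countable, its elements are
  absorbed one at a time: cutting off sufficiently low degrees leaves a quotient with degrees
  bounded below, whose basis can be lifted so that the given element lies in its span. Finally every
  element of \<open>I\<close> lies in a countable closed set, so Zorn's lemma reaches \<open>I\<close>.
\<close>

section \<open>Internal direct sums\<close>

locale graded_group = abelian_group G for G :: "('g, 'r) ring_scheme" (structure) +
  fixes D :: "'i \<Rightarrow> 'g set"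
  assumes direct_sum: "internal_direct_sum G D"
begin

lemma subgroup_D: "subgroup (D i) (add_monoid G)"
  using direct_sum by (simp add: internal_direct_sum_def)

lemma D_closed: "x \<in> D i \<Longrightarrow> x \<in> carrier G"
  using subgroup.subset[OF subgroup_D] by auto

lemma D_zero: "\<zero> \<in> D i"
  using subgroup.one_closed[OF subgroup_D] by simp

lemma D_add: "x \<in> D i \<Longrightarrow> y \<in> D i \<Longrightarrow> x \<oplus> y \<in> D i"
  using subgroup.m_closed[OF subgroup_D] by simp

lemma D_minus: "x \<in> D i \<Longrightarrow> \<ominus> x \<in> D i"
  using subgroup.m_inv_closed[OF subgroup_D] by (simp add: a_inv_def)

lemma D_finsum: "finite S \<Longrightarrow> (\<And>j. j \<in> S \<Longrightarrow> m j \<in> D i) \<Longrightarrow> (\<Oplus>j\<in>S. m j) \<in> D i"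
proof (induction S rule: finite_induct)
  case empty
  then show ?case by (simp add: D_zero)
next
  case (insert j S)
  then show ?case by (subst finsum_insert) (auto intro: D_closed D_add)
qed

definition is_decomp :: "'g \<Rightarrow> ('i \<Rightarrow> 'g) \<Rightarrow> bool" where
  "is_decomp x c \<longleftrightarrow> (\<forall>i. c i \<in> D i) \<and> finite {i. c i \<noteq> \<zero>} \<and> x = (\<Oplus>i\<in>{i. c i \<noteq> \<zero>}. c i)"

definition decomp :: "'g \<Rightarrow> 'i \<Rightarrow> 'g" where
  "decomp x = (THE c. is_decomp x c)"

lemma ex1_decomp: "x \<in> carrier G \<Longrightarrow> \<exists>!c. is_decomp x c"
  using direct_sum by (simp add: internal_direct_sum_def is_decomp_def)

lemma is_decomp_decomp: "x \<in> carrier G \<Longrightarrow> is_decomp x (decomp x)"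
  unfolding decomp_def by (rule theI'[OF ex1_decomp])

lemma decomp_eqI: "x \<in> carrier G \<Longrightarrow> is_decomp x c \<Longrightarrow> decomp x = c"
  using ex1_decomp is_decomp_decomp by blast

lemma decomp_in: "x \<in> carrier G \<Longrightarrow> decomp x i \<in> D i"
  and decomp_finite: "x \<in> carrier G \<Longrightarrow> finite {i. decomp x i \<noteq> \<zero>}"
  and decomp_sum: "x \<in> carrier G \<Longrightarrow> x = (\<Oplus>i\<in>{i. decomp x i \<noteq> \<zero>}. decomp x i)"
  using is_decomp_decomp[of x] unfolding is_decomp_def by auto

lemma finsum_extend:
  assumes "finite S" "{i. c i \<noteq> \<zero>} \<subseteq> S" "\<And>i. c i \<in> carrier G"
  shows "(\<Oplus>i\<in>{i. c i \<noteq> \<zero>}. c i) = (\<Oplus>i\<in>S. c i)"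
  by (rule add.finprod_mono_neutral_cong_left) (use assms in auto)

lemma decomp_homogeneous:
  assumes "x \<in> D i"
  shows "decomp x j = (if j = i then x else \<zero>)"
proof -
  let ?c = "\<lambda>j. if j = i then x else \<zero>"
  have "(\<Oplus>j\<in>{j. ?c j \<noteq> \<zero>}. ?c j) = (\<Oplus>j\<in>{i}. ?c j)"
    by (rule finsum_extend) (use assms D_closed in auto)
  then have "is_decomp x ?c"
    using assms D_closed[OF assms] by (auto simp: is_decomp_def D_zero intro: finite_subset[of _ "{i}"])
  with decomp_eqI[OF D_closed[OF assms]] show ?thesis by simp
qed

lemma decomp_add:
  assumes "x \<in> carrier G" "y \<in> carrier G"
  shows "decomp (x \<oplus> y) j = decomp x j \<oplus> decomp y j"
proof -
  let ?c = "\<lambda>j. decomp x j \<oplus> decomp y j"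
  let ?S = "{i. decomp x i \<noteq> \<zero>} \<union> {i. decomp y i \<noteq> \<zero>}"
  note cl = decomp_in[THEN D_closed]
  have S: "finite ?S" using assms decomp_finite by auto
  have "{i. ?c i \<noteq> \<zero>} \<subseteq> ?S" by auto
  moreover have "x \<oplus> y = (\<Oplus>i\<in>?S. ?c i)"
  proof -
    have "x = (\<Oplus>i\<in>?S. decomp x i)" "y = (\<Oplus>i\<in>?S. decomp y i)"
      using decomp_sum[OF assms(1)] decomp_sum[OF assms(2)]
        finsum_extend[OF S, of "decomp x"] finsum_extend[OF S, of "decomp y"] cl assms by auto
    then show ?thesis
      using finsum_addf[of "decomp x" ?S "decomp y"] cl assms by auto
  qed
  ultimately have "is_decomp (x \<oplus> y) ?c"
    unfolding is_decomp_def using S assms cl finsum_extend[OF S, of ?c]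
    by (auto intro: D_add decomp_in finite_subset)
  with decomp_eqI show ?thesis using assms by simp
qed

lemma decomp_finsum:
  assumes "finite S" "\<And>j. j \<in> S \<Longrightarrow> m j \<in> carrier G"
  shows "decomp (\<Oplus>j\<in>S. m j) i = (\<Oplus>j\<in>S. decomp (m j) i)"
  using assms
proof (induction S rule: finite_induct)
  case empty
  then show ?case using decomp_homogeneous[OF D_zero] by simp
next
  case (insert j S)
  then show ?case using decomp_in[THEN D_closed] by (auto simp: decomp_add Pi_iff)
qed

text \<open>Each element is the finite sum of its components; zero is homogeneous, which covers the
  empty sum.\<close>

lemma additive_induct [consumes 1, case_names homogeneous add]:
  assumes x: "x \<in> carrier G"
    and hom: "\<And>i y. y \<in> D i \<Longrightarrow> Q y"
    and add: "\<And>y z. y \<in> carrier G \<Longrightarrow> z \<in> carrier G \<Longrightarrow> Q y \<Longrightarrow> Q z \<Longrightarrow> Q (y \<oplus> z)"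
  shows "Q x"
proof -
  note cl = decomp_in[OF x, THEN D_closed]
  have "Q (\<Oplus>i\<in>S. decomp x i)" if "finite S" for S
    using that
  proof (induction S rule: finite_induct)
    case empty
    then show ?case using hom[OF D_zero] by simp
  next
    case (insert i S)
    then show ?case using cl hom[OF decomp_in[OF x]] by (simp add: add)
  qed
  from this[OF decomp_finite[OF x]] show ?thesis using decomp_sum[OF x] by simp
qed

text \<open>Additivity on a component makes \<open>h i\<close> send zero to zero, so the sum of the
  images of the components may run over any finite set containing the support, and two elements can
  be compared on a common set. The index is an argument of \<open>h\<close> because the maps to be
  glued depend on the degree.\<close>

lemma additive_extension:
  assumes "abelian_group H"
    and h: "\<And>i x. x \<in> D i \<Longrightarrow> h i x \<in> carrier H"
    and h_add: "\<And>i x y. x \<in> D i \<Longrightarrow> y \<in> D i \<Longrightarrow> h i (x \<oplus> y) = h i x \<oplus>\<^bsub>H\<^esub> h i y"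
  shows "\<exists>f\<in>carrier G \<rightarrow> carrier H.
    (\<forall>x\<in>carrier G. \<forall>y\<in>carrier G. f (x \<oplus> y) = f x \<oplus>\<^bsub>H\<^esub> f y) \<and> (\<forall>i. \<forall>x\<in>D i. f x = h i x)"
proof -
  interpret H: abelian_group H by fact
  have h0: "h i \<zero> = \<zero>\<^bsub>H\<^esub>" for i
    using h_add[OF D_zero D_zero, of i] h[OF D_zero, of i] by simp
  define f where "f x = (\<Oplus>\<^bsub>H\<^esub>i\<in>{i. decomp x i \<noteq> \<zero>}. h i (decomp x i))" for x
  have f: "f x = (\<Oplus>\<^bsub>H\<^esub>i\<in>S. h i (decomp x i))"
    if "x \<in> carrier G" "finite S" "{i. decomp x i \<noteq> \<zero>} \<subseteq> S" for x S
    unfolding f_def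
    by (rule H.add.finprod_mono_neutral_cong_left)
      (use that h decomp_in in \<open>auto simp: h0\<close>)
  have "f x \<in> carrier H" if "x \<in> carrier G" for x
    unfolding f_def using h decomp_in[OF that] by auto
  moreover have "f (x \<oplus> y) = f x \<oplus>\<^bsub>H\<^esub> f y" if xy: "x \<in> carrier G" "y \<in> carrier G" for x y
  proof -
    let ?S = "{i. decomp x i \<noteq> \<zero>} \<union> {i. decomp y i \<noteq> \<zero>}"
    have S: "finite ?S" using xy decomp_finite by auto
    have "f (x \<oplus> y) = (\<Oplus>\<^bsub>H\<^esub>i\<in>?S. h i (decomp (x \<oplus> y) i))"
      by (rule f) (use xy S in \<open>auto simp: decomp_add\<close>)
    also have "\<dots> = (\<Oplus>\<^bsub>H\<^esub>i\<in>?S. h i (decomp x i) \<oplus>\<^bsub>H\<^esub> h i (decomp y i))"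
      by (rule H.finsum_cong')
        (use xy h decomp_in in \<open>auto simp: decomp_add h_add Pi_iff\<close>)
    also have "\<dots> = f x \<oplus>\<^bsub>H\<^esub> f y"
      using f[OF xy(1) S] f[OF xy(2) S] h decomp_in xy by (simp add: H.finsum_addf Pi_iff)
    finally show ?thesis .
  qed
  moreover have "f x = h i x" if "x \<in> D i" for i x
  proof -
    have "f x = (\<Oplus>\<^bsub>H\<^esub>j\<in>{i}. h j (decomp x j))"
      by (rule f) (use that D_closed in \<open>auto simp: decomp_homogeneous[OF that]\<close>)
    then show ?thesis using h[OF that] by (simp add: decomp_homogeneous[OF that])
  qed
  ultimately show ?thesis by (intro bexI[of _ f]) auto
qed

end

section \<open>Bases relative to a submodule\<close>

abbreviation coefs :: "('a, 'r) ring_scheme \<Rightarrow> 'i set \<Rightarrow> ('i \<Rightarrow> 'a) set" where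
  "coefs A S \<equiv> carrier (free_rmodule A S)"

lemma coefs_iff:
  "c \<in> coefs A S \<longleftrightarrow>
    (\<forall>i. c i \<in> carrier A) \<and> (\<forall>i. i \<notin> S \<longrightarrow> c i = \<zero>\<^bsub>A\<^esub>) \<and> finite {i. c i \<noteq> \<zero>\<^bsub>A\<^esub>}"
  by (simp add: free_rmodule_def)

lemma coefs_mono: "S \<subseteq> T \<Longrightarrow> c \<in> coefs A S \<Longrightarrow> c \<in> coefs A T"
  by (auto simp: coefs_iff)

context right_module
begin

section \<open>Coefficient functions and linear combinations of elements of \<open>P\<close>\<close>

abbreviation lc :: "('c \<Rightarrow> 'a) \<Rightarrow> 'c" where
  "lc \<equiv> lin_comb A P (\<lambda>x. x)"

lemma lc_hom: "lc \<in> rmod_hom A (free_rmodule A (carrier P)) P"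
  by (rule lin_comb_hom) (simp_all add: right_module_axioms)

lemma coefs_module: "right_module A (free_rmodule A S)"
  by (rule right_module_free_rmodule) (rule A.ring_axioms)

lemma coefs_add:
  assumes "c \<in> coefs A S" "d \<in> coefs A S"
  shows "(\<lambda>i. c i \<oplus>\<^bsub>A\<^esub> d i) \<in> coefs A S"
proof -
  interpret F: right_module A "free_rmodule A S" by (rule coefs_module)
  show ?thesis using F.P.a_closed[OF assms] by (simp add: free_rmodule_def)
qed

lemma coefs_ract:
  assumes "c \<in> coefs A S" "a \<in> carrier A"
  shows "(\<lambda>i. c i \<otimes>\<^bsub>A\<^esub> a) \<in> coefs A S"
proof -
  interpret F: right_module A "free_rmodule A S" by (rule coefs_module)
  show ?thesis using F.ract_closed[OF assms] by (simp add: free_rmodule_def)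
qed

lemma coefs_zero: "(\<lambda>_. \<zero>\<^bsub>A\<^esub>) \<in> coefs A S"
  by (simp add: coefs_iff)

lemma coefs_single: "b \<in> S \<Longrightarrow> a \<in> carrier A \<Longrightarrow> (\<lambda>i. if i = b then a else \<zero>\<^bsub>A\<^esub>) \<in> coefs A S"
  by (auto simp: coefs_iff)

lemma coefs_restrict: "c \<in> coefs A S \<Longrightarrow> (\<lambda>i. if i \<in> T then c i else \<zero>\<^bsub>A\<^esub>) \<in> coefs A T"
  by (auto simp: coefs_iff elim: rev_finite_subset)

lemma lc_closed: "c \<in> coefs A (carrier P) \<Longrightarrow> lc c \<in> carrier P"
  by (rule rmod_hom_closed[OF lc_hom])

lemma lc_add:
  assumes "c \<in> coefs A (carrier P)" "d \<in> coefs A (carrier P)"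
  shows "lc (\<lambda>i. c i \<oplus>\<^bsub>A\<^esub> d i) = lc c \<oplus>\<^bsub>P\<^esub> lc d"
  using rmod_hom_add[OF lc_hom assms] by (simp add: free_rmodule_def)

lemma lc_ract:
  assumes "c \<in> coefs A (carrier P)" "a \<in> carrier A"
  shows "lc (\<lambda>i. c i \<otimes>\<^bsub>A\<^esub> a) = lc c \<cdot>\<^bsub>P\<^esub> a"
  using rmod_hom_ract[OF lc_hom assms] by (simp add: free_rmodule_def)

lemma lc_zero: "lc (\<lambda>_. \<zero>\<^bsub>A\<^esub>) = \<zero>\<^bsub>P\<^esub>"
  by (simp add: lin_comb_def)

lemma lc_superset:
  assumes "c \<in> coefs A (carrier P)" "finite S" "{i. c i \<noteq> \<zero>\<^bsub>A\<^esub>} \<subseteq> S" "S \<subseteq> carrier P"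
  shows "lc c = (\<Oplus>\<^bsub>P\<^esub>i\<in>S. i \<cdot>\<^bsub>P\<^esub> c i)"
  by (rule lin_comb_superset[OF right_module_axioms _ assms]) simp

lemma lc_single:
  assumes "b \<in> carrier P" "a \<in> carrier A"
  shows "lc (\<lambda>i. if i = b then a else \<zero>\<^bsub>A\<^esub>) = b \<cdot>\<^bsub>P\<^esub> a"
proof -
  have "lc (\<lambda>i. if i = b then a else \<zero>\<^bsub>A\<^esub>) = (\<Oplus>\<^bsub>P\<^esub>i\<in>{b}. i \<cdot>\<^bsub>P\<^esub> (if i = b then a else \<zero>\<^bsub>A\<^esub>))"
    by (rule lc_superset[OF coefs_single]) (use assms in auto)
  then show ?thesis using assms by simp
qed

section \<open>Right submodules\<close>

definition rsubmodule :: "'c set \<Rightarrow> bool" where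
  "rsubmodule V \<longleftrightarrow> V \<subseteq> carrier P \<and> \<zero>\<^bsub>P\<^esub> \<in> V \<and>
    (\<forall>x\<in>V. \<forall>y\<in>V. x \<oplus>\<^bsub>P\<^esub> y \<in> V) \<and> (\<forall>x\<in>V. \<forall>a\<in>carrier A. x \<cdot>\<^bsub>P\<^esub> a \<in> V)"

lemma rsubmodule_closed: "rsubmodule V \<Longrightarrow> x \<in> V \<Longrightarrow> x \<in> carrier P"
  and rsubmodule_zero: "rsubmodule V \<Longrightarrow> \<zero>\<^bsub>P\<^esub> \<in> V"
  and rsubmodule_add: "rsubmodule V \<Longrightarrow> x \<in> V \<Longrightarrow> y \<in> V \<Longrightarrow> x \<oplus>\<^bsub>P\<^esub> y \<in> V"
  and rsubmodule_ract: "rsubmodule V \<Longrightarrow> x \<in> V \<Longrightarrow> a \<in> carrier A \<Longrightarrow> x \<cdot>\<^bsub>P\<^esub> a \<in> V"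
  by (auto simp: rsubmodule_def)

lemma ract_minus_one: "x \<in> carrier P \<Longrightarrow> x \<cdot>\<^bsub>P\<^esub> (\<ominus>\<^bsub>A\<^esub> \<one>\<^bsub>A\<^esub>) = \<ominus>\<^bsub>P\<^esub> x"
  using ract_r_distr[of x "\<one>\<^bsub>A\<^esub>" "\<ominus>\<^bsub>A\<^esub> \<one>\<^bsub>A\<^esub>"]
  by (intro P.minus_equality[symmetric]) (auto simp: A.r_neg P.a_comm)

lemma rsubmodule_minus: "rsubmodule V \<Longrightarrow> x \<in> V \<Longrightarrow> \<ominus>\<^bsub>P\<^esub> x \<in> V"
  using rsubmodule_ract[of V x "\<ominus>\<^bsub>A\<^esub> \<one>\<^bsub>A\<^esub>"] ract_minus_one rsubmodule_closed by auto

lemma rsubmodule_add_cancel: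
  assumes "rsubmodule V" "x \<in> V" "y \<in> carrier P" "x \<oplus>\<^bsub>P\<^esub> y \<in> V"
  shows "y \<in> V"
proof -
  have "y = \<ominus>\<^bsub>P\<^esub> x \<oplus>\<^bsub>P\<^esub> (x \<oplus>\<^bsub>P\<^esub> y)"
    using assms rsubmodule_closed by (simp add: P.r_neg2 P.r_neg1)
  with assms show ?thesis by (metis rsubmodule_add rsubmodule_minus)
qed

lemma rsubmodule_lc:
  assumes "rsubmodule V" "c \<in> coefs A (carrier P)" "\<And>i. c i \<noteq> \<zero>\<^bsub>A\<^esub> \<Longrightarrow> i \<in> V"
  shows "lc c \<in> V"
proof -
  have c: "c i \<in> carrier A" for i using assms(2) by (simp add: coefs_iff)
  have "(\<Oplus>\<^bsub>P\<^esub>i\<in>S. i \<cdot>\<^bsub>P\<^esub> c i) \<in> V" if "finite S" "S \<subseteq> V" for S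
    using that
  proof (induction S rule: finite_induct)
    case empty
    then show ?case using assms by (simp add: rsubmodule_zero)
  next
    case (insert i S)
    then have "\<And>j. j \<in> insert i S \<Longrightarrow> j \<in> carrier P" using assms(1) rsubmodule_closed by blast
    then show ?case using insert c assms(1)
      by (auto simp: Pi_iff intro: rsubmodule_add rsubmodule_ract)
  qed
  then show ?thesis unfolding lin_comb_def using assms by (auto simp: coefs_iff)
qed

text \<open>Together with \<open>indep_over\<close> this expresses spanning and independence in the
  quotient by \<open>V\<close> through representatives in \<open>P\<close>, so that no quotient
  module is formed.\<close>

definition span_over :: "'c set \<Rightarrow> 'c set \<Rightarrow> 'c set" where
  "span_over V B = {u \<oplus>\<^bsub>P\<^esub> lc c | u c. u \<in> V \<and> c \<in> coefs A B}"

definition indep_over :: "'c set \<Rightarrow> 'c set \<Rightarrow> bool" where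
  "indep_over V B \<longleftrightarrow> (\<forall>c\<in>coefs A B. lc c \<in> V \<longrightarrow> c = (\<lambda>_. \<zero>\<^bsub>A\<^esub>))"

lemma span_overI: "u \<in> V \<Longrightarrow> c \<in> coefs A B \<Longrightarrow> u \<oplus>\<^bsub>P\<^esub> lc c \<in> span_over V B"
  by (auto simp: span_over_def)

lemma span_over_mono: "V \<subseteq> V' \<Longrightarrow> B \<subseteq> B' \<Longrightarrow> span_over V B \<subseteq> span_over V' B'"
  unfolding span_over_def using coefs_mono by blast

lemma rsubmodule_span_over:
  assumes V: "rsubmodule V" and B: "B \<subseteq> carrier P"
  shows "rsubmodule (span_over V B)"
proof -
  note cl = lc_closed[OF coefs_mono[OF B]] rsubmodule_closed[OF V]
  have "\<zero>\<^bsub>P\<^esub> \<in> span_over V B"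
    using span_overI[OF rsubmodule_zero[OF V] coefs_zero[of B]] by (simp add: lc_zero)
  moreover have "x \<oplus>\<^bsub>P\<^esub> y \<in> span_over V B" if "x \<in> span_over V B" "y \<in> span_over V B" for x y
  proof -
    obtain u c v d where x: "x = u \<oplus>\<^bsub>P\<^esub> lc c" "u \<in> V" "c \<in> coefs A B"
      and y: "y = v \<oplus>\<^bsub>P\<^esub> lc d" "v \<in> V" "d \<in> coefs A B"
      using \<open>x \<in> _\<close> \<open>y \<in> _\<close> by (auto simp: span_over_def)
    have "x \<oplus>\<^bsub>P\<^esub> y = (u \<oplus>\<^bsub>P\<^esub> v) \<oplus>\<^bsub>P\<^esub> lc (\<lambda>i. c i \<oplus>\<^bsub>A\<^esub> d i)"
      using x y cl by (simp add: lc_add coefs_mono[OF B] P.a_ac)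
    then show ?thesis using x y by (simp add: span_overI coefs_add rsubmodule_add[OF V])
  qed
  moreover have "x \<cdot>\<^bsub>P\<^esub> a \<in> span_over V B" if "x \<in> span_over V B" "a \<in> carrier A" for x a
  proof -
    obtain u c where x: "x = u \<oplus>\<^bsub>P\<^esub> lc c" "u \<in> V" "c \<in> coefs A B"
      using \<open>x \<in> _\<close> by (auto simp: span_over_def)
    have "x \<cdot>\<^bsub>P\<^esub> a = (u \<cdot>\<^bsub>P\<^esub> a) \<oplus>\<^bsub>P\<^esub> lc (\<lambda>i. c i \<otimes>\<^bsub>A\<^esub> a)"
      using x cl that(2) by (simp add: lc_ract coefs_mono[OF B] ract_l_distr)
    then show ?thesis using x that(2) by (simp add: span_overI coefs_ract rsubmodule_ract[OF V])
  qed
  moreover have "span_over V B \<subseteq> carrier P" using cl by (auto simp: span_over_def)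
  ultimately show ?thesis by (simp add: rsubmodule_def)
qed

lemma base_in_span_over:
  assumes "rsubmodule V" "B \<subseteq> carrier P"
  shows "V \<subseteq> span_over V B"
proof
  fix u assume "u \<in> V"
  then show "u \<in> span_over V B"
    using span_overI[OF _ coefs_zero, of u V B] rsubmodule_closed[OF assms(1)] by (simp add: lc_zero)
qed

lemma span_over_lc:
  assumes "rsubmodule V" "B \<subseteq> carrier P" "c \<in> coefs A B"
  shows "lc c \<in> span_over V B"
  using span_overI[OF rsubmodule_zero[OF assms(1)] assms(3)] lc_closed[OF coefs_mono[OF assms(2,3)]]
  by simp

lemma gen_in_span_over:
  assumes "rsubmodule V" "B \<subseteq> carrier P"
  shows "B \<subseteq> span_over V B"
proof
  fix b assume "b \<in> B"
  then show "b \<in> span_over V B"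
    using span_over_lc[OF assms coefs_single, of b "\<one>\<^bsub>A\<^esub>"] lc_single[of b "\<one>\<^bsub>A\<^esub>"] assms(2) by auto
qed

text \<open>For submodules \<open>V \<subseteq> V'\<close> this is a chosen set of lifts of a free
  basis of the quotient. Fixed lifts allow bases of successive quotients to be united.\<close>

definition relbasis :: "'c set \<Rightarrow> 'c set \<Rightarrow> 'c set \<Rightarrow> bool" where
  "relbasis V V' B \<longleftrightarrow> B \<subseteq> V' \<and> V' \<subseteq> span_over V B \<and> indep_over V B"

lemma relbasis_refl:
  assumes "rsubmodule V"
  shows "relbasis V V {}"
  using base_in_span_over[OF assms, of "{}"] by (auto simp: relbasis_def indep_over_def coefs_iff)

text \<open>Spanning is a matter of substitution. A relation modulo \<open>V0\<close> is also one
  modulo \<open>V1\<close>; that kills its coefficients on \<open>B2\<close>, and what remains is a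
  relation on \<open>B1\<close> alone.\<close>

lemma relbasis_trans:
  assumes V: "rsubmodule V0" "rsubmodule V1" "rsubmodule V2" "V0 \<subseteq> V1" "V1 \<subseteq> V2"
    and 1: "relbasis V0 V1 B1" and 2: "relbasis V1 V2 B2"
  shows "relbasis V0 V2 (B1 \<union> B2)"
proof -
  let ?B = "B1 \<union> B2"
  have B: "B1 \<subseteq> V1" "B2 \<subseteq> V2" "?B \<subseteq> carrier P"
    using 1 2 V rsubmodule_closed by (auto simp: relbasis_def)
  note sub = rsubmodule_span_over[OF V(1) B(3)]
  have "V1 \<subseteq> span_over V0 ?B"
    using 1 span_over_mono[of V0 V0 B1 ?B] by (auto simp: relbasis_def)
  moreover have "lc c \<in> span_over V0 ?B" if "c \<in> coefs A B2" for c
    by (rule span_over_lc[OF V(1) B(3)]) (rule coefs_mono[OF _ that], simp)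
  ultimately have "V2 \<subseteq> span_over V0 ?B"
    using 2 rsubmodule_add[OF sub] unfolding relbasis_def span_over_def[of V1] by blast
  moreover have "indep_over V0 ?B"
    unfolding indep_over_def
  proof (intro ballI impI)
    fix c assume c: "c \<in> coefs A ?B" "lc c \<in> V0"
    \<comment> \<open>The two sets are not assumed disjoint; common elements are counted with
      \<open>B2\<close>, so that the two parts add up to \<open>c\<close>.\<close>
    let ?c1 = "\<lambda>i. if i \<in> B1 - B2 then c i else \<zero>\<^bsub>A\<^esub>" and ?c2 = "\<lambda>i. if i \<in> B2 then c i else \<zero>\<^bsub>A\<^esub>"
    have c1: "?c1 \<in> coefs A (B1 - B2)" and c2: "?c2 \<in> coefs A B2" using coefs_restrict[OF c(1)] by blast+
    then have c12: "?c1 \<in> coefs A (carrier P)" "?c2 \<in> coefs A (carrier P)"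
      using B by (auto elim!: coefs_mono[rotated])
    have "c = (\<lambda>i. ?c1 i \<oplus>\<^bsub>A\<^esub> ?c2 i)"
      using c(1) by (auto simp: coefs_iff fun_eq_iff)
    then have lc: "lc c = lc ?c1 \<oplus>\<^bsub>P\<^esub> lc ?c2"
      using lc_add[OF c12] by simp
    moreover have "lc ?c1 \<in> V1"
      by (rule rsubmodule_lc[OF V(2) c12(1)]) (use B in \<open>auto split: if_splits\<close>)
    ultimately have "lc ?c2 \<in> V1"
      using rsubmodule_add_cancel[OF V(2) _ lc_closed[OF c12(2)]] c(2) V(4) by auto
    then have "?c2 = (\<lambda>_. \<zero>\<^bsub>A\<^esub>)" using 2 c2 by (auto simp: relbasis_def indep_over_def)
    then have "c i = \<zero>\<^bsub>A\<^esub>" if "i \<in> B2" for i using that by (auto dest: fun_cong[of _ _ i])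
    then have "c \<in> coefs A B1" using c(1) by (auto simp: coefs_iff)
    then show "c = (\<lambda>_. \<zero>\<^bsub>A\<^esub>)" using 1 c(2) by (auto simp: relbasis_def indep_over_def)
  qed
  ultimately show ?thesis using B V by (auto simp: relbasis_def)
qed

text \<open>A relation has finite support. This carries independence through unions of chains and of
  increasing sequences.\<close>

lemma indep_over_directed:
  assumes fin: "\<And>S. finite S \<Longrightarrow> S \<subseteq> B \<Longrightarrow> \<exists>B'. S \<subseteq> B' \<and> indep_over V B'"
  shows "indep_over V B"
  unfolding indep_over_def
proof (intro ballI impI)
  fix c assume c: "c \<in> coefs A B" "lc c \<in> V"
  then have "finite {i. c i \<noteq> \<zero>\<^bsub>A\<^esub>}" "{i. c i \<noteq> \<zero>\<^bsub>A\<^esub>} \<subseteq> B" by (auto simp: coefs_iff)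
  then obtain B' where "{i. c i \<noteq> \<zero>\<^bsub>A\<^esub>} \<subseteq> B'" "indep_over V B'" using fin by blast
  moreover from this have "c \<in> coefs A B'" using c(1) by (auto simp: coefs_iff)
  ultimately show "c = (\<lambda>_. \<zero>\<^bsub>A\<^esub>)" using c(2) by (auto simp: indep_over_def)
qed

lemma free_basis_if_relbasis:
  assumes "relbasis {\<zero>\<^bsub>P\<^esub>} (carrier P) B"
  shows "free_basis A P B"
proof -
  have B: "B \<subseteq> carrier P" using assms by (simp add: relbasis_def)
  have "\<exists>!c. c \<in> coefs A B \<and> x = lc c" if x: "x \<in> carrier P" for x
  proof (rule ex_ex1I)
    obtain c where "c \<in> coefs A B" "x = \<zero>\<^bsub>P\<^esub> \<oplus>\<^bsub>P\<^esub> lc c"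
      using assms x by (auto simp: relbasis_def span_over_def)
    then show "\<exists>c. c \<in> coefs A B \<and> x = lc c"
      using lc_closed[OF coefs_mono[OF B]] by auto
  next
    fix c d assume cd: "c \<in> coefs A B \<and> x = lc c" "d \<in> coefs A B \<and> x = lc d"
    \<comment> \<open>The difference of the two coefficient functions is written as \<open>c\<close>
      plus \<open>d\<close> times minus one, so that linearity of \<open>lc\<close> applies;
      independence over zero then makes it vanish.\<close>
    let ?d = "\<lambda>i. d i \<otimes>\<^bsub>A\<^esub> (\<ominus>\<^bsub>A\<^esub> \<one>\<^bsub>A\<^esub>)"
    have d: "?d \<in> coefs A B" using cd by (intro coefs_ract) auto
    have "lc (\<lambda>i. c i \<oplus>\<^bsub>A\<^esub> ?d i) = x \<oplus>\<^bsub>P\<^esub> \<ominus>\<^bsub>P\<^esub> x"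
      using lc_add[OF coefs_mono[OF B] coefs_mono[OF B d], of c]
        lc_ract[OF coefs_mono[OF B], of d "\<ominus>\<^bsub>A\<^esub> \<one>\<^bsub>A\<^esub>"] cd ract_minus_one[OF x] by auto
    then have "(\<lambda>i. c i \<oplus>\<^bsub>A\<^esub> ?d i) = (\<lambda>_. \<zero>\<^bsub>A\<^esub>)"
      using assms coefs_add[of c B ?d] cd d x by (auto simp: relbasis_def indep_over_def P.r_neg)
    then have "c i \<oplus>\<^bsub>A\<^esub> ?d i = \<zero>\<^bsub>A\<^esub>" for i by meson
    then have "\<ominus>\<^bsub>A\<^esub> ?d i = c i" for i using cd by (intro A.minus_equality) (auto simp: coefs_iff)
    then have "c i = d i" for i using cd by (simp add: coefs_iff A.r_minus)
    then show "c = d" by (rule ext)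
  qed
  moreover have "c \<in> coefs A B \<longleftrightarrow> (\<forall>b\<in>B. c b \<in> carrier A) \<and> (\<forall>b. b \<notin> B \<longrightarrow> c b = \<zero>\<^bsub>A\<^esub>) \<and>
      finite {b. c b \<noteq> \<zero>\<^bsub>A\<^esub>}" for c
    unfolding coefs_iff by (metis A.zero_closed)
  ultimately show ?thesis using B unfolding free_basis_def lin_comb_def by (simp add: conj_assoc)
qed

end

section \<open>Homogeneous splittings\<close>

locale graded_module_over_connected =
  connected_graded_algebra K A A_gr + graded_right_module A A_gr P P_gr
  for K :: "('k, 'r) ring_scheme" and A :: "('k, 'a, 's) module_scheme" and A_gr :: "nat \<Rightarrow> 'a set"
    and P :: "('a, 'p, 't) rmodule_scheme" and P_gr :: "int \<Rightarrow> 'p set"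
begin

sublocale AD: graded_group A A_gr
  by unfold_locales (rule A_gr_direct_sum)

sublocale PD: graded_group P P_gr
  by unfold_locales (rule P_gr_direct_sum)

section \<open>The component of degree zero as a division ring\<close>

lemma one_in_A0: "\<one>\<^bsub>A\<^esub> \<in> A_gr 0"
proof -
  have "\<one>\<^bsub>K\<^esub> \<odot>\<^bsub>A\<^esub> \<one>\<^bsub>A\<^esub> \<in> A_gr 0" using bij_betwE[OF connected] by blast
  then show ?thesis by (simp add: smult_one)
qed

lemma one_neq_zero: "\<one>\<^bsub>A\<^esub> \<noteq> \<zero>\<^bsub>A\<^esub>"
proof
  assume "\<one>\<^bsub>A\<^esub> = \<zero>\<^bsub>A\<^esub>"
  then have "\<one>\<^bsub>K\<^esub> \<odot>\<^bsub>A\<^esub> \<one>\<^bsub>A\<^esub> = \<zero>\<^bsub>K\<^esub> \<odot>\<^bsub>A\<^esub> \<one>\<^bsub>A\<^esub>" by (simp add: smult_l_null)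
  then have "\<one>\<^bsub>K\<^esub> = \<zero>\<^bsub>K\<^esub>"
    using inj_onD[OF bij_betw_imp_inj_on[OF connected]] by blast
  then show False by simp
qed

text \<open>The unit map is a bijection from the field onto \<open>A_gr 0\<close>, so the inverse of
  a nonzero scalar can be transported.\<close>

lemma A0_inverse:
  assumes "x \<in> A_gr 0" "x \<noteq> \<zero>\<^bsub>A\<^esub>"
  obtains y where "y \<in> A_gr 0" "x \<otimes>\<^bsub>A\<^esub> y = \<one>\<^bsub>A\<^esub>" "y \<otimes>\<^bsub>A\<^esub> x = \<one>\<^bsub>A\<^esub>"
proof -
  obtain c where c: "c \<in> carrier K" "x = c \<odot>\<^bsub>A\<^esub> \<one>\<^bsub>A\<^esub>"
    using assms connected by (auto simp: bij_betw_def)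
  have "c \<noteq> \<zero>\<^bsub>K\<^esub>" using c assms(2) smult_l_null by auto
  then have i: "inv\<^bsub>K\<^esub> c \<in> carrier K" "c \<otimes>\<^bsub>K\<^esub> inv\<^bsub>K\<^esub> c = \<one>\<^bsub>K\<^esub>" "inv\<^bsub>K\<^esub> c \<otimes>\<^bsub>K\<^esub> c = \<one>\<^bsub>K\<^esub>"
    using c K.field_Units by auto
  have "(inv\<^bsub>K\<^esub> c) \<odot>\<^bsub>A\<^esub> \<one>\<^bsub>A\<^esub> \<in> A_gr 0" using connected i by (auto simp: bij_betw_def)
  moreover have "x \<otimes>\<^bsub>A\<^esub> ((inv\<^bsub>K\<^esub> c) \<odot>\<^bsub>A\<^esub> \<one>\<^bsub>A\<^esub>) = \<one>\<^bsub>A\<^esub>" "((inv\<^bsub>K\<^esub> c) \<odot>\<^bsub>A\<^esub> \<one>\<^bsub>A\<^esub>) \<otimes>\<^bsub>A\<^esub> x = \<one>\<^bsub>A\<^esub>"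
    using c i by (simp_all add: smult_mult_left smult_assoc1[symmetric])
  ultimately show ?thesis by (rule that)
qed

lemma A0_mult: "x \<in> A_gr 0 \<Longrightarrow> y \<in> A_gr 0 \<Longrightarrow> x \<otimes>\<^bsub>A\<^esub> y \<in> A_gr 0"
  using A_gr_mult[of x 0 y 0] by simp

text \<open>Gaussian elimination over the division ring \<open>A\<^sub>0\<close>.\<close>

lemma A0_dependence:
  assumes "finite S" "\<And>b i. b \<in> S \<Longrightarrow> i \<in> L \<Longrightarrow> v b i \<in> A_gr 0" "\<And>b. b \<in> S \<Longrightarrow> a b \<in> carrier A"
    and "\<And>i. i \<in> L \<Longrightarrow> (\<Oplus>\<^bsub>A\<^esub>b\<in>S. v b i \<otimes>\<^bsub>A\<^esub> a b) = \<zero>\<^bsub>A\<^esub>" "\<exists>b\<in>S. a b \<noteq> \<zero>\<^bsub>A\<^esub>"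
  shows "\<exists>l. (\<forall>b\<in>S. l b \<in> A_gr 0) \<and> (\<exists>b\<in>S. l b \<noteq> \<zero>\<^bsub>A\<^esub>) \<and>
    (\<forall>i\<in>L. (\<Oplus>\<^bsub>A\<^esub>b\<in>S. v b i \<otimes>\<^bsub>A\<^esub> l b) = \<zero>\<^bsub>A\<^esub>)"
  using assms
\<comment> \<open>Columns are removed one at a time. The matrix \<open>v\<close> varies because row
  operations change it, while the given solution \<open>a\<close> over the whole of \<open>A\<close>
  stays the same.\<close>
proof (induction S arbitrary: v rule: finite_induct)
  case empty
  then show ?case by simp
next
  case (insert b0 S)
  note v = insert.prems(1) note a = insert.prems(2)
  have vc: "v b i \<in> carrier A" if "b \<in> insert b0 S" "i \<in> L" for b i
    using v[OF that] by (rule AD.D_closed)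
  show ?case
  proof (cases "\<forall>i\<in>L. v b0 i = \<zero>\<^bsub>A\<^esub>")
    case True
    \<comment> \<open>The column of \<open>b0\<close> vanishes on \<open>L\<close>, so the unit
      vector at \<open>b0\<close> is a solution over \<open>A_gr 0\<close>.\<close>
    let ?l = "\<lambda>b. if b = b0 then \<one>\<^bsub>A\<^esub> else \<zero>\<^bsub>A\<^esub>"
    have "(\<Oplus>\<^bsub>A\<^esub>b\<in>insert b0 S. v b i \<otimes>\<^bsub>A\<^esub> ?l b) = \<zero>\<^bsub>A\<^esub>" if "i \<in> L" for i
    proof -
      have "(\<Oplus>\<^bsub>A\<^esub>b\<in>insert b0 S. v b i \<otimes>\<^bsub>A\<^esub> ?l b) = (\<Oplus>\<^bsub>A\<^esub>b\<in>insert b0 S. \<zero>\<^bsub>A\<^esub>)"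
        by (rule A.finsum_cong') (use True that vc in auto)
      then show ?thesis by simp
    qed
    then show ?thesis using one_in_A0 one_neq_zero AD.D_zero by (intro exI[of _ ?l]) auto
  next
    case False
    then obtain i0 where i0: "i0 \<in> L" "v b0 i0 \<noteq> \<zero>\<^bsub>A\<^esub>" by blast
    obtain w where w: "w \<in> A_gr 0" "w \<otimes>\<^bsub>A\<^esub> v b0 i0 = \<one>\<^bsub>A\<^esub>"
      using A0_inverse[OF v i0(2)] i0(1) by blast
    have wc: "w \<in> carrier A" using w AD.D_closed by blast
    \<comment> \<open>Row \<open>i0\<close> is the pivot row: adding \<open>q i\<close> times it to
      row \<open>i\<close> clears the entry in column \<open>b0\<close>. The remaining columns form
      the matrix \<open>v'\<close>, still with entries of degree zero.\<close>
    define q where "q i = \<ominus>\<^bsub>A\<^esub> (v b0 i \<otimes>\<^bsub>A\<^esub> w)" for i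
    define v' where "v' b i = v b i \<oplus>\<^bsub>A\<^esub> q i \<otimes>\<^bsub>A\<^esub> v b i0" for b i
    have q: "q i \<in> A_gr 0" "q i \<in> carrier A" if "i \<in> L" for i
      using v[of b0 i] that w by (auto simp: q_def AD.D_minus A0_mult intro: AD.D_closed)
    have v'0: "v' b i \<in> A_gr 0" if "b \<in> S" "i \<in> L" for b i
      unfolding v'_def using that i0 by (intro AD.D_add A0_mult q v) auto
    define X where "X a i = (\<Oplus>\<^bsub>A\<^esub>b\<in>S. v b i \<otimes>\<^bsub>A\<^esub> a b)" for a i
    have X: "X a i \<in> carrier A" if "i \<in> L" "\<And>b. b \<in> S \<Longrightarrow> a b \<in> carrier A" for a i
      unfolding X_def using that vc by (intro A.finsum_closed) auto
    have sum_v': "(\<Oplus>\<^bsub>A\<^esub>b\<in>S. v' b i \<otimes>\<^bsub>A\<^esub> a b) = X a i \<oplus>\<^bsub>A\<^esub> q i \<otimes>\<^bsub>A\<^esub> X a i0"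
      if "i \<in> L" "\<And>b. b \<in> S \<Longrightarrow> a b \<in> carrier A" for a i
    proof -
      have "(\<Oplus>\<^bsub>A\<^esub>b\<in>S. v' b i \<otimes>\<^bsub>A\<^esub> a b)
          = (\<Oplus>\<^bsub>A\<^esub>b\<in>S. v b i \<otimes>\<^bsub>A\<^esub> a b \<oplus>\<^bsub>A\<^esub> q i \<otimes>\<^bsub>A\<^esub> (v b i0 \<otimes>\<^bsub>A\<^esub> a b))"
        by (rule A.finsum_cong')
          (use that vc q i0 in \<open>auto simp: v'_def A.l_distr A.m_assoc\<close>)
      also have "\<dots> = X a i \<oplus>\<^bsub>A\<^esub> (\<Oplus>\<^bsub>A\<^esub>b\<in>S. q i \<otimes>\<^bsub>A\<^esub> (v b i0 \<otimes>\<^bsub>A\<^esub> a b))"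
        unfolding X_def using that vc q i0 by (intro A.finsum_addf) auto
      also have "(\<Oplus>\<^bsub>A\<^esub>b\<in>S. q i \<otimes>\<^bsub>A\<^esub> (v b i0 \<otimes>\<^bsub>A\<^esub> a b)) = q i \<otimes>\<^bsub>A\<^esub> X a i0"
        unfolding X_def using that vc q i0 insert.hyps(1)
        by (intro A.finsum_rdistr[symmetric]) auto
      finally show ?thesis .
    qed
    have sum_insert: "(\<Oplus>\<^bsub>A\<^esub>b\<in>insert b0 S. v b i \<otimes>\<^bsub>A\<^esub> a b) = v b0 i \<otimes>\<^bsub>A\<^esub> a b0 \<oplus>\<^bsub>A\<^esub> X a i"
      if "i \<in> L" "\<And>b. b \<in> insert b0 S \<Longrightarrow> a b \<in> carrier A" for a i
      unfolding X_def using insert.hyps that vc by (intro A.finsum_insert) auto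
    have Xa: "X a i = \<ominus>\<^bsub>A\<^esub> (v b0 i \<otimes>\<^bsub>A\<^esub> a b0)" if "i \<in> L" for i
      using insert.prems(3)[OF that] sum_insert[OF that a] X[OF that, of a] a vc that
      by (intro A.minus_equality[symmetric]) (auto simp: A.a_comm)
    have dep': "(\<Oplus>\<^bsub>A\<^esub>b\<in>S. v' b i \<otimes>\<^bsub>A\<^esub> a b) = \<zero>\<^bsub>A\<^esub>" if "i \<in> L" for i
    proof -
      have "q i \<otimes>\<^bsub>A\<^esub> X a i0 = (v b0 i \<otimes>\<^bsub>A\<^esub> w) \<otimes>\<^bsub>A\<^esub> (v b0 i0 \<otimes>\<^bsub>A\<^esub> a b0)"
        using Xa[OF i0(1)] that i0 vc wc a by (simp add: q_def A.l_minus A.r_minus)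
      also have "\<dots> = v b0 i \<otimes>\<^bsub>A\<^esub> ((w \<otimes>\<^bsub>A\<^esub> v b0 i0) \<otimes>\<^bsub>A\<^esub> a b0)"
        using that i0 vc wc a by (simp add: A.m_assoc)
      also have "\<dots> = v b0 i \<otimes>\<^bsub>A\<^esub> a b0" using w a by simp
      finally show ?thesis
        using sum_v'[OF that, of a] Xa[OF that] a vc that by (simp add: A.l_neg)
    qed
    \<comment> \<open>Otherwise the pivot row reduces to its entry at \<open>b0\<close> times
      \<open>a b0\<close>, and the left inverse \<open>w\<close> forces \<open>a b0\<close> to
      vanish as well.\<close>
    have "\<exists>b\<in>S. a b \<noteq> \<zero>\<^bsub>A\<^esub>"
    proof (rule ccontr)
      assume "\<not> (\<exists>b\<in>S. a b \<noteq> \<zero>\<^bsub>A\<^esub>)"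
      then have az: "a b0 \<noteq> \<zero>\<^bsub>A\<^esub>" and "X a i0 = (\<Oplus>\<^bsub>A\<^esub>b\<in>S. \<zero>\<^bsub>A\<^esub>)"
        unfolding X_def using vc i0 insert.prems(4) by (blast, intro A.finsum_cong') auto
      then have "v b0 i0 \<otimes>\<^bsub>A\<^esub> a b0 = \<zero>\<^bsub>A\<^esub>"
        using insert.prems(3)[OF i0(1)] sum_insert[OF i0(1) a] vc i0 a by simp
      then have "w \<otimes>\<^bsub>A\<^esub> (v b0 i0 \<otimes>\<^bsub>A\<^esub> a b0) = \<zero>\<^bsub>A\<^esub>" using wc by simp
      then show False using az w wc vc i0 a by (simp add: A.m_assoc[symmetric])
    qed
    from insert.IH[of v', OF v'0 _ dep' this] a
    obtain l where l: "\<forall>b\<in>S. l b \<in> A_gr 0" "\<exists>b\<in>S. l b \<noteq> \<zero>\<^bsub>A\<^esub>"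
      "\<forall>i\<in>L. (\<Oplus>\<^bsub>A\<^esub>b\<in>S. v' b i \<otimes>\<^bsub>A\<^esub> l b) = \<zero>\<^bsub>A\<^esub>" by blast
    have lc: "b \<in> S \<Longrightarrow> l b \<in> carrier A" for b using l(1) AD.D_closed by blast
    \<comment> \<open>Back substitution: the value at \<open>b0\<close> is found by solving the
      pivot row for it.\<close>
    define l' where "l' = l(b0 := \<ominus>\<^bsub>A\<^esub> (w \<otimes>\<^bsub>A\<^esub> X l i0))"
    have X0: "X l i0 \<in> A_gr 0"
      unfolding X_def using l(1) v i0 insert.hyps(1) by (intro AD.D_finsum) (auto intro: A0_mult)
    have l': "l' b \<in> A_gr 0" if "b \<in> insert b0 S" for b
      using that l(1) X0 w by (auto simp: l'_def AD.D_minus A0_mult)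
    have "(\<Oplus>\<^bsub>A\<^esub>b\<in>insert b0 S. v b i \<otimes>\<^bsub>A\<^esub> l' b) = \<zero>\<^bsub>A\<^esub>" if "i \<in> L" for i
    proof -
      have "X l' i = X l i"
        unfolding X_def using insert.hyps lc vc that
        by (intro A.finsum_cong') (auto simp: l'_def)
      moreover have "v b0 i \<otimes>\<^bsub>A\<^esub> l' b0 = q i \<otimes>\<^bsub>A\<^esub> X l i0"
        using vc wc that X[of i0 l, OF i0(1) lc] by (simp add: l'_def q_def A.l_minus A.r_minus A.m_assoc)
      moreover have "X l i \<oplus>\<^bsub>A\<^esub> q i \<otimes>\<^bsub>A\<^esub> X l i0 = \<zero>\<^bsub>A\<^esub>"
        using bspec[OF l(3) that] sum_v'[of i l, OF that lc] by simp
      ultimately show ?thesis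
        using sum_insert[OF that, of l', OF l'[THEN AD.D_closed]] X[of i l, OF that lc] X[of i0 l, OF i0(1) lc] q that
        by (simp add: A.a_comm)
    qed
    moreover have "\<exists>b\<in>insert b0 S. l' b \<noteq> \<zero>\<^bsub>A\<^esub>"
      using l(2) insert.hyps(2) by (auto simp: l'_def)
    ultimately show ?thesis using l' by (intro exI[of _ l']) auto
  qed
qed

text \<open>The degree is an integer since it will be a difference of degrees in \<open>P\<close>;
  negative degrees give zero, as \<open>A\<close> has no component there.\<close>

definition gpart :: "int \<Rightarrow> 'a \<Rightarrow> 'a" where
  "gpart m a = (if 0 \<le> m then AD.decomp a (nat m) else \<zero>\<^bsub>A\<^esub>)"

lemma gpart_in: "a \<in> carrier A \<Longrightarrow> 0 \<le> m \<Longrightarrow> gpart m a \<in> A_gr (nat m)"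
  by (simp add: gpart_def AD.decomp_in)

lemma gpart_closed [simp]: "a \<in> carrier A \<Longrightarrow> gpart m a \<in> carrier A"
  by (auto simp: gpart_def intro: AD.D_closed AD.decomp_in)

lemma gpart_add:
  "a \<in> carrier A \<Longrightarrow> b \<in> carrier A \<Longrightarrow> gpart m (a \<oplus>\<^bsub>A\<^esub> b) = gpart m a \<oplus>\<^bsub>A\<^esub> gpart m b"
  by (simp add: gpart_def AD.decomp_add)

lemma gpart_homogeneous: "a \<in> A_gr j \<Longrightarrow> gpart m a = (if m = int j then a else \<zero>\<^bsub>A\<^esub>)"
  by (auto simp: gpart_def AD.decomp_homogeneous)

lemma gpart_zero [simp]: "gpart m \<zero>\<^bsub>A\<^esub> = \<zero>\<^bsub>A\<^esub>"
  using gpart_homogeneous[OF AD.D_zero[of 0]] by simp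

lemma gpart_mult:
  assumes "a \<in> carrier A" "b \<in> A_gr j"
  shows "gpart m (a \<otimes>\<^bsub>A\<^esub> b) = gpart (m - int j) a \<otimes>\<^bsub>A\<^esub> b"
  using assms(1)
proof (induction rule: AD.additive_induct)
  case (homogeneous k a)
  then show ?case
    using gpart_homogeneous[OF A_gr_mult[OF homogeneous assms(2)], of m] assms AD.D_closed
    by (auto simp: gpart_homogeneous[OF homogeneous])
next
  case (add x y)
  then show ?case using AD.D_closed[OF assms(2)] by (simp add: A.l_distr gpart_add)
qed

lemma decomp_ract:
  assumes "x \<in> P_gr e" "a \<in> carrier A"
  shows "PD.decomp (x \<cdot>\<^bsub>P\<^esub> a) d = x \<cdot>\<^bsub>P\<^esub> gpart (d - e) a"
  using assms(2)
proof (induction rule: AD.additive_induct)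
  case (homogeneous k a)
  then show ?case
    using PD.decomp_homogeneous[OF P_gr_ract[OF assms(1) homogeneous], of d] PD.D_closed[OF assms(1)]
    by (auto simp: gpart_homogeneous[OF homogeneous])
next
  case (add y z)
  then show ?case
    using PD.D_closed[OF assms(1)] by (simp add: ract_r_distr gpart_add PD.decomp_add)
qed

end

text \<open>\<open>\<Phi>\<close> is a graded section of the canonical map from the free module on
  \<open>I\<close>, whose generator at \<open>i\<close> is placed in degree \<open>deg i\<close>. As
  \<open>A\<close> lives in nonnegative degrees, an element of degree \<open>d\<close> uses only
  generators of degree at most \<open>d\<close>; the degree arguments below rest on this.\<close>

locale graded_splitting = graded_module_over_connected K A A_gr P P_gr
  for K :: "('k, 'r) ring_scheme" and A :: "('k, 'a, 's) module_scheme" and A_gr :: "nat \<Rightarrow> 'a set"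
    and P :: "('a, 'p, 't) rmodule_scheme" and P_gr :: "int \<Rightarrow> 'p set" +
  fixes I :: "'p set" and deg :: "'p \<Rightarrow> int" and \<Phi> :: "'p \<Rightarrow> 'p \<Rightarrow> 'a"
  assumes I_deg: "i \<in> I \<Longrightarrow> i \<in> P_gr (deg i)"
    and \<Phi>_hom: "\<Phi> \<in> rmod_hom A P (free_rmodule A I)"
    and lc_\<Phi>: "x \<in> carrier P \<Longrightarrow> lc (\<Phi> x) = x"
    and \<Phi>_deg: "\<lbrakk>x \<in> P_gr d; i \<in> I; \<Phi> x i \<noteq> \<zero>\<^bsub>A\<^esub>\<rbrakk> \<Longrightarrow> deg i \<le> d \<and> \<Phi> x i \<in> A_gr (nat (d - deg i))"

text \<open>Projectivity splits the surjection onto \<open>P\<close> from the free module on all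
  homogeneous elements. This surjection preserves degrees, so the degree-preserving part of the
  splitting is again a splitting.\<close>

lemma (in graded_module_over_connected) ex_graded_splitting:
  assumes "projective A P"
  shows "\<exists>I deg \<Phi>. graded_splitting K A A_gr P P_gr I deg \<Phi>"
proof -
  define I where "I = (\<Union>d. P_gr d)"
  \<comment> \<open>Zero lies in every component, hence a choice; a nonzero homogeneous element has
    only one degree.\<close>
  define deg where "deg x = (SOME d. x \<in> P_gr d)" for x
  have I_deg: "x \<in> P_gr (deg x)" if "x \<in> I" for x
    using that unfolding deg_def I_def by (auto intro: someI)
  have I: "I \<subseteq> carrier P" using PD.D_closed by (auto simp: I_def)
  let ?F = "free_rmodule A I"
  interpret F: right_module A ?F by (rule coefs_module)
  have lcF: "lc \<in> rmod_hom A ?F P"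
    using I by (intro lin_comb_hom[OF right_module_axioms]) auto
  have surj: "x \<in> lc ` coefs A I" if "x \<in> carrier P" for x
    using that
  proof (induction rule: PD.additive_induct)
    case (homogeneous d x)
    then have x: "x \<in> I" by (auto simp: I_def)
    then show ?case
      using lc_single[of x "\<one>\<^bsub>A\<^esub>"] I
      by (intro rev_image_eqI[OF coefs_single[OF x, of "\<one>\<^bsub>A\<^esub>"]]) auto
  next
    case (add x y)
    then obtain c d where "c \<in> coefs A I" "x = lc c" "d \<in> coefs A I" "y = lc d" by auto
    then show ?case
      using coefs_add lc_add[OF coefs_mono[OF I] coefs_mono[OF I], of c d]
      by (intro rev_image_eqI[of "\<lambda>i. c i \<oplus>\<^bsub>A\<^esub> d i"]) auto
  qed
  have "\<exists>s\<in>rmod_hom A P ?F. \<forall>x\<in>carrier P. lc (s x) = x"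
    by (rule projective_lifting[OF assms F.right_module_axioms right_module_axioms lcF])
      (use surj rmod_hom_closed[OF lcF] in \<open>auto simp: rmod_hom_def\<close>)
  then obtain s where s: "s \<in> rmod_hom A P ?F" "\<And>x. x \<in> carrier P \<Longrightarrow> lc (s x) = x" by blast
  have s_coefs: "s x \<in> coefs A I" if "x \<in> carrier P" for x
    by (rule rmod_hom_closed[OF s(1) that])
  have s_closed: "s x i \<in> carrier A" if "x \<in> carrier P" for x i
    using s_coefs[OF that] by (simp add: coefs_iff)
  \<comment> \<open>The part of degree \<open>d\<close> of \<open>s x\<close> in the free module
    with shifted generators. It depends on \<open>d\<close>, so it is first used on each component
    of \<open>P\<close> separately and then extended additively.\<close>
  define h where "h d x i = gpart (d - deg i) (s x i)" for d x i
  have h_coefs: "h d x \<in> coefs A I" if "x \<in> carrier P" for d x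
    using s_coefs[OF that] by (auto simp: h_def coefs_iff elim!: rev_finite_subset)
  have h_add: "h d (x \<oplus>\<^bsub>P\<^esub> y) = h d x \<oplus>\<^bsub>?F\<^esub> h d y" if "x \<in> carrier P" "y \<in> carrier P" for d x y
    using rmod_hom_add[OF s(1) that] s_closed that
    by (auto simp: h_def free_rmodule_def gpart_add fun_eq_iff)
  have "\<exists>\<Phi>\<in>carrier P \<rightarrow> coefs A I.
      (\<forall>x\<in>carrier P. \<forall>y\<in>carrier P. \<Phi> (x \<oplus>\<^bsub>P\<^esub> y) = \<Phi> x \<oplus>\<^bsub>?F\<^esub> \<Phi> y) \<and> (\<forall>d. \<forall>x\<in>P_gr d. \<Phi> x = h d x)"
    by (rule PD.additive_extension[OF F.P.abelian_group_axioms])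
      (simp_all add: h_coefs h_add PD.D_closed)
  then obtain \<Phi> where \<Phi>: "\<Phi> \<in> carrier P \<rightarrow> coefs A I"
      "\<And>x y. x \<in> carrier P \<Longrightarrow> y \<in> carrier P \<Longrightarrow> \<Phi> (x \<oplus>\<^bsub>P\<^esub> y) = \<Phi> x \<oplus>\<^bsub>?F\<^esub> \<Phi> y"
      "\<And>d x. x \<in> P_gr d \<Longrightarrow> \<Phi> x = h d x"
    by auto
  \<comment> \<open>By additivity in both arguments it suffices to treat homogeneous
    \<open>x\<close> and \<open>a\<close>; there the degree of \<open>a\<close> shifts the extracted
    part by exactly the amount in \<open>gpart_mult\<close>.\<close>
  have \<Phi>_ract: "\<Phi> (x \<cdot>\<^bsub>P\<^esub> a) = \<Phi> x \<cdot>\<^bsub>?F\<^esub> a" if "x \<in> carrier P" "a \<in> carrier A" for x a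
    using that(1)
  proof (induction rule: PD.additive_induct)
    case (homogeneous d x)
    have x: "x \<in> carrier P" using homogeneous PD.D_closed by blast
    show ?case using that(2)
    proof (induction rule: AD.additive_induct)
      case (homogeneous m a)
      have "\<Phi> (x \<cdot>\<^bsub>P\<^esub> a) = h (d + int m) (x \<cdot>\<^bsub>P\<^esub> a)"
        by (rule \<Phi>(3)[OF P_gr_ract[OF \<open>x \<in> P_gr d\<close> homogeneous]])
      also have "\<dots> = h d x \<cdot>\<^bsub>?F\<^esub> a"
        using rmod_hom_ract[OF s(1) x AD.D_closed[OF homogeneous]] gpart_mult[OF s_closed[OF x] homogeneous]
        by (auto simp: h_def free_rmodule_def fun_eq_iff algebra_simps)
      finally show ?case by (simp add: \<Phi>(3)[OF \<open>x \<in> P_gr d\<close>])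
    next
      case (add a b)
      have "\<Phi> x \<in> coefs A I" using \<Phi>(1) x by auto
      with add x show ?case by (simp add: ract_r_distr F.ract_r_distr \<Phi>(2))
    qed
  next
    case (add x y)
    have "\<Phi> x \<in> coefs A I" "\<Phi> y \<in> coefs A I" using \<Phi>(1) add by auto
    with add that(2) show ?case by (simp add: ract_l_distr F.ract_l_distr \<Phi>(2))
  qed
  have lc_\<Phi>: "lc (\<Phi> x) = x" if "x \<in> carrier P" for x
    using that
  proof (induction rule: PD.additive_induct)
    case (homogeneous d x)
    have x: "x \<in> carrier P" using homogeneous PD.D_closed by blast
    let ?S = "{i. s x i \<noteq> \<zero>\<^bsub>A\<^esub>}"
    have S: "finite ?S" "?S \<subseteq> I" using s_coefs[OF x] by (auto simp: coefs_iff)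
    \<comment> \<open>The projection to degree \<open>d\<close> fixes \<open>x\<close> and turns
      each coordinate of \<open>s x\<close> into its degree-preserving part.\<close>
    have "x = PD.decomp (lc (s x)) d" using s(2)[OF x] PD.decomp_homogeneous[OF homogeneous] by simp
    also have "\<dots> = (\<Oplus>\<^bsub>P\<^esub>i\<in>?S. PD.decomp (i \<cdot>\<^bsub>P\<^esub> s x i) d)"
      unfolding lin_comb_def using S I s_closed[OF x] by (intro PD.decomp_finsum) auto
    also have "\<dots> = (\<Oplus>\<^bsub>P\<^esub>i\<in>?S. i \<cdot>\<^bsub>P\<^esub> h d x i)"
      using S I s_closed[OF x] decomp_ract[OF I_deg s_closed[OF x]]
      by (intro P.finsum_cong') (auto simp: h_def)
    also have "\<dots> = lc (h d x)"
      by (rule lc_superset[symmetric, OF coefs_mono[OF I h_coefs[OF x]]])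
        (use S I in \<open>auto simp: h_def\<close>)
    finally show ?case by (simp add: \<Phi>(3)[OF homogeneous])
  next
    case (add x y)
    then show ?case using \<Phi> rmod_hom_add[OF lcF, of "\<Phi> x" "\<Phi> y"] by auto
  qed
  have "graded_splitting K A A_gr P P_gr I deg \<Phi>"
  proof
    show "\<Phi> \<in> rmod_hom A P ?F" using \<Phi> \<Phi>_ract by (auto simp: rmod_hom_def)
  next
    fix x d i assume x: "x \<in> P_gr d" and nz: "\<Phi> x i \<noteq> \<zero>\<^bsub>A\<^esub>"
    then show "deg i \<le> d \<and> \<Phi> x i \<in> A_gr (nat (d - deg i))"
      using gpart_in[OF s_closed[OF PD.D_closed[OF x]], of "d - deg i" i]
      by (auto simp: \<Phi>(3)[OF x] h_def) (auto simp: gpart_def split: if_splits)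
  qed (use I_deg lc_\<Phi> in auto)
  then show ?thesis by blast
qed

section \<open>Submodules generated by closed index sets\<close>

context graded_splitting
begin

lemma I_closed: "I \<subseteq> carrier P"
  using I_deg PD.D_closed by blast

lemma \<Phi>_coefs: "x \<in> carrier P \<Longrightarrow> \<Phi> x \<in> coefs A I"
  by (rule rmod_hom_closed[OF \<Phi>_hom])

lemma \<Phi>_closed: "x \<in> carrier P \<Longrightarrow> \<Phi> x i \<in> carrier A"
  and \<Phi>_outside: "x \<in> carrier P \<Longrightarrow> i \<notin> I \<Longrightarrow> \<Phi> x i = \<zero>\<^bsub>A\<^esub>"
  and \<Phi>_finite: "x \<in> carrier P \<Longrightarrow> finite {i. \<Phi> x i \<noteq> \<zero>\<^bsub>A\<^esub>}"
  using \<Phi>_coefs[of x] by (auto simp: coefs_iff)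

lemma \<Phi>_add: "x \<in> carrier P \<Longrightarrow> y \<in> carrier P \<Longrightarrow> \<Phi> (x \<oplus>\<^bsub>P\<^esub> y) i = \<Phi> x i \<oplus>\<^bsub>A\<^esub> \<Phi> y i"
  using rmod_hom_add[OF \<Phi>_hom, of x y] by (simp add: free_rmodule_def)

lemma \<Phi>_ract: "x \<in> carrier P \<Longrightarrow> a \<in> carrier A \<Longrightarrow> \<Phi> (x \<cdot>\<^bsub>P\<^esub> a) i = \<Phi> x i \<otimes>\<^bsub>A\<^esub> a"
  using rmod_hom_ract[OF \<Phi>_hom, of x a] by (simp add: free_rmodule_def)

lemma \<Phi>_zero: "\<Phi> \<zero>\<^bsub>P\<^esub> i = \<zero>\<^bsub>A\<^esub>"
  using rmod_hom_zero[OF right_module_axioms coefs_module \<Phi>_hom] by (simp add: free_rmodule_def)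

lemma \<Phi>_lc:
  assumes c: "c \<in> coefs A (carrier P)"
  shows "\<Phi> (lc c) i = (\<Oplus>\<^bsub>A\<^esub>b\<in>{b. c b \<noteq> \<zero>\<^bsub>A\<^esub>}. \<Phi> b i \<otimes>\<^bsub>A\<^esub> c b)"
proof -
  have "\<Phi> (\<Oplus>\<^bsub>P\<^esub>b\<in>S. b \<cdot>\<^bsub>P\<^esub> c b) i = (\<Oplus>\<^bsub>A\<^esub>b\<in>S. \<Phi> b i \<otimes>\<^bsub>A\<^esub> c b)"
    if "finite S" "S \<subseteq> carrier P" for S
    using that
  proof (induction S rule: finite_induct)
    case empty
    then show ?case by (simp add: \<Phi>_zero)
  next
    case (insert b S)
    then have "\<And>b'. b' \<in> insert b S \<Longrightarrow> b' \<in> carrier P" "c b' \<in> carrier A" for b'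
      using c by (auto simp: coefs_iff)
    then show ?case using insert by (simp add: \<Phi>_add \<Phi>_ract \<Phi>_closed Pi_iff)
  qed
  then show ?thesis using c unfolding lin_comb_def by (auto simp: coefs_iff)
qed

definition U :: "'p set \<Rightarrow> 'p set" where
  "U J = {x \<in> carrier P. \<forall>i. i \<notin> J \<longrightarrow> \<Phi> x i = \<zero>\<^bsub>A\<^esub>}"

definition closed_idx :: "'p set \<Rightarrow> bool" where
  "closed_idx J \<longleftrightarrow> J \<subseteq> I \<and> J \<subseteq> U J"

definition \<rho> :: "'p set \<Rightarrow> 'p \<Rightarrow> 'p" where
  "\<rho> J x = lc (\<lambda>i. if i \<in> J then \<Phi> x i else \<zero>\<^bsub>A\<^esub>)"

lemma rsubmodule_U: "rsubmodule (U J)"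
  by (auto simp: rsubmodule_def U_def \<Phi>_zero \<Phi>_add \<Phi>_ract)

lemma U_closed: "U J \<subseteq> carrier P"
  by (auto simp: U_def)

lemma U_mono: "J \<subseteq> J' \<Longrightarrow> U J \<subseteq> U J'"
  by (auto simp: U_def)

lemma U_I: "U I = carrier P"
  using \<Phi>_outside by (auto simp: U_def)

lemma U_empty: "U {} = {\<zero>\<^bsub>P\<^esub>}"
proof -
  have "x = \<zero>\<^bsub>P\<^esub>" if "x \<in> U {}" for x
  proof -
    have "\<Phi> x = (\<lambda>_. \<zero>\<^bsub>A\<^esub>)" using that by (auto simp: U_def)
    then show ?thesis using lc_\<Phi>[of x] that by (simp add: U_def lc_zero)
  qed
  then show ?thesis using rsubmodule_zero[OF rsubmodule_U] by blast
qed

text \<open>The elements of \<open>U J\<close> are combinations of \<open>J\<close> through their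
  own coordinates. Hence spanning of \<open>U J\<close> need only be tested on \<open>J\<close>, and
  for closed \<open>J\<close> it is exactly the submodule generated by \<open>J\<close>.\<close>

lemma U_least:
  assumes "rsubmodule V" "J \<subseteq> V"
  shows "U J \<subseteq> V"
proof
  fix x assume x: "x \<in> U J"
  then have xP: "x \<in> carrier P" using U_closed by blast
  have "lc (\<Phi> x) \<in> V"
    by (rule rsubmodule_lc[OF assms(1) coefs_mono[OF I_closed \<Phi>_coefs[OF xP]]])
      (use x assms(2) in \<open>auto simp: U_def\<close>)
  then show "x \<in> V" by (simp add: lc_\<Phi> xP)
qed

lemma closed_idxI:
  assumes "J \<subseteq> I" "\<And>j i. j \<in> J \<Longrightarrow> \<Phi> j i \<noteq> \<zero>\<^bsub>A\<^esub> \<Longrightarrow> i \<in> J"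
  shows "closed_idx J"
  using assms I_closed by (auto simp: closed_idx_def U_def)

lemma closed_idxD: "closed_idx J \<Longrightarrow> j \<in> J \<Longrightarrow> \<Phi> j i \<noteq> \<zero>\<^bsub>A\<^esub> \<Longrightarrow> i \<in> J"
  by (auto simp: closed_idx_def U_def)

lemma closed_idx_Un: "closed_idx J \<Longrightarrow> closed_idx J' \<Longrightarrow> closed_idx (J \<union> J')"
  by (auto simp: closed_idx_def U_def)

text \<open>The coordinates of an index element never have larger degree than the element, so
  cutting off high degrees keeps a closed set closed.\<close>

lemma closed_idx_deg_less:
  assumes "closed_idx J"
  shows "closed_idx {i \<in> J. deg i < n}"
proof (rule closed_idxI)
  show "{i \<in> J. deg i < n} \<subseteq> I" using assms by (auto simp: closed_idx_def)
  fix j i assume "j \<in> {i \<in> J. deg i < n}" "\<Phi> j i \<noteq> \<zero>\<^bsub>A\<^esub>"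
  moreover from this have "i \<in> J" "j \<in> I" "i \<in> I"
    using closed_idxD[OF assms] assms by (auto simp: closed_idx_def)
  ultimately show "i \<in> {i \<in> J. deg i < n}"
    using \<Phi>_deg[OF I_deg, of j i] by auto
qed

section \<open>Truncation of coordinates and its kernel\<close>

lemma \<rho>_coefs: "x \<in> carrier P \<Longrightarrow> (\<lambda>i. if i \<in> J then \<Phi> x i else \<zero>\<^bsub>A\<^esub>) \<in> coefs A (carrier P)"
  using coefs_mono[OF I_closed \<Phi>_coefs[of x]] by (auto simp: coefs_iff elim: rev_finite_subset)

text \<open>The target \<open>V\<close> is arbitrary and only indices that occur in \<open>x\<close>
  matter; this lets a truncation land in a submodule smaller than \<open>U J\<close>.\<close>

lemma \<rho>_in:
  assumes "rsubmodule V" "x \<in> carrier P" "\<And>i. i \<in> J \<Longrightarrow> \<Phi> x i \<noteq> \<zero>\<^bsub>A\<^esub> \<Longrightarrow> i \<in> V"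
  shows "\<rho> J x \<in> V"
  unfolding \<rho>_def
  by (rule rsubmodule_lc[OF assms(1) \<rho>_coefs[OF assms(2)]]) (use assms(3) in \<open>auto split: if_splits\<close>)

lemma \<rho>_in_U: "closed_idx J \<Longrightarrow> x \<in> carrier P \<Longrightarrow> \<rho> J x \<in> U J"
  by (rule \<rho>_in[OF rsubmodule_U]) (auto simp: closed_idx_def)

lemma \<rho>_closed: "x \<in> carrier P \<Longrightarrow> \<rho> J x \<in> carrier P"
  unfolding \<rho>_def by (rule lc_closed[OF \<rho>_coefs])

lemma \<rho>_id:
  assumes "x \<in> U J"
  shows "\<rho> J x = x"
proof -
  have "(\<lambda>i. if i \<in> J then \<Phi> x i else \<zero>\<^bsub>A\<^esub>) = \<Phi> x" using assms by (auto simp: U_def)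
  then show ?thesis using assms lc_\<Phi>[of x] by (simp add: \<rho>_def U_def)
qed

lemma \<rho>_add:
  assumes "x \<in> carrier P" "y \<in> carrier P"
  shows "\<rho> J (x \<oplus>\<^bsub>P\<^esub> y) = \<rho> J x \<oplus>\<^bsub>P\<^esub> \<rho> J y"
  unfolding \<rho>_def lc_add[OF \<rho>_coefs[OF assms(1)] \<rho>_coefs[OF assms(2)], symmetric]
  by (rule arg_cong[where f = lc]) (use assms in \<open>auto simp: \<Phi>_add\<close>)

lemma \<rho>_ract:
  assumes "x \<in> carrier P" "a \<in> carrier A"
  shows "\<rho> J (x \<cdot>\<^bsub>P\<^esub> a) = \<rho> J x \<cdot>\<^bsub>P\<^esub> a"
  unfolding \<rho>_def lc_ract[OF \<rho>_coefs[OF assms(1)] assms(2), symmetric]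
  by (rule arg_cong[where f = lc]) (use assms in \<open>auto simp: \<Phi>_ract\<close>)

lemma \<rho>_minus: "x \<in> carrier P \<Longrightarrow> \<rho> J (\<ominus>\<^bsub>P\<^esub> x) = \<ominus>\<^bsub>P\<^esub> \<rho> J x"
  using \<rho>_ract[of x "\<ominus>\<^bsub>A\<^esub> \<one>\<^bsub>A\<^esub>" J] by (simp add: ract_minus_one \<rho>_closed)

text \<open>For closed \<open>J\<close> this is the complement of \<open>U J\<close> determined by
  the retraction \<open>\<rho> J\<close>.\<close>

definition kernel :: "'p set \<Rightarrow> 'p set" where
  "kernel J = {x \<in> carrier P. \<rho> J x = \<zero>\<^bsub>P\<^esub>}"

lemma rsubmodule_kernel: "rsubmodule (kernel J)"
  using \<rho>_id[OF rsubmodule_zero[OF rsubmodule_U], of J]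
  by (auto simp: rsubmodule_def kernel_def \<rho>_add \<rho>_ract)

lemma minus_\<rho>_in_kernel:
  assumes "closed_idx J" "x \<in> carrier P"
  shows "x \<oplus>\<^bsub>P\<^esub> \<ominus>\<^bsub>P\<^esub> \<rho> J x \<in> kernel J"
  using assms \<rho>_id[OF \<rho>_in_U[OF assms]] \<rho>_closed[OF assms(2)]
  by (auto simp: kernel_def \<rho>_add \<rho>_minus P.r_neg)

lemma \<rho>_homogeneous:
  assumes "x \<in> P_gr d"
  shows "\<rho> J x \<in> P_gr d"
proof -
  have x: "x \<in> carrier P" using assms PD.D_closed by blast
  let ?c = "\<lambda>i. if i \<in> J then \<Phi> x i else \<zero>\<^bsub>A\<^esub>"
  have "i \<cdot>\<^bsub>P\<^esub> ?c i \<in> P_gr d" if "?c i \<noteq> \<zero>\<^bsub>A\<^esub>" for i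
  proof -
    have i: "i \<in> J" "\<Phi> x i \<noteq> \<zero>\<^bsub>A\<^esub>" "i \<in> I" using that \<Phi>_outside[OF x] by (auto split: if_splits)
    show ?thesis
      using P_gr_ract[OF I_deg[OF i(3)], of "\<Phi> x i" "nat (d - deg i)"]
        \<Phi>_deg[OF assms i(3,2)] i(1) by simp
  qed
  then show ?thesis
    unfolding \<rho>_def lin_comb_def using \<rho>_coefs[OF x, of J] by (intro PD.D_finsum) (auto simp: coefs_iff)
qed

text \<open>The coordinates of elements of degree \<open>n\<close> at new indices have degree zero.
  A relation over \<open>A\<close> modulo \<open>U J\<close> among such elements can therefore be
  replaced by one over the division ring \<open>A_gr 0\<close> and solved for a term, so a maximal
  independent set spans. The set \<open>W\<close> prescribes where the basis is chosen.\<close>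

lemma relbasis_single_degree:
  assumes J: "closed_idx J" "closed_idx J'" "J \<subseteq> J'"
    and deg: "\<And>i. i \<in> J' - J \<Longrightarrow> deg i = n"
    and W: "\<And>i. i \<in> J' - J \<Longrightarrow> \<exists>u\<in>U J. \<exists>w\<in>W \<inter> P_gr n \<inter> U J'. i = u \<oplus>\<^bsub>P\<^esub> w"
  shows "\<exists>B\<subseteq>W \<inter> P_gr n. relbasis (U J) (U J') B"
proof -
  let ?X = "W \<inter> P_gr n \<inter> U J'"
  let ?\<A> = "{B. B \<subseteq> ?X \<and> indep_over (U J) B}"
  have "\<exists>M\<in>?\<A>. \<forall>X\<in>?\<A>. M \<subseteq> X \<longrightarrow> X = M"
  proof (rule subset_Zorn')
    fix C assume C: "subset.chain ?\<A> C"
    then have sub: "C \<subseteq> ?\<A>" by (auto simp: subset_chain_def)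
    have "indep_over (U J) (\<Union>C)"
    proof (rule indep_over_directed)
      fix S assume S: "finite S" "S \<subseteq> \<Union>C"
      show "\<exists>B'. S \<subseteq> B' \<and> indep_over (U J) B'"
      proof (cases "C = {}")
        case True
        then show ?thesis using S by (intro exI[of _ "{}"]) (auto simp: indep_over_def coefs_iff)
      next
        case False
        obtain B' where "B' \<in> C" "S \<subseteq> B'" by (rule finite_subset_Union_chain[OF S False C])
        then show ?thesis using sub by (intro exI[of _ B']) auto
      qed
    qed
    then show "\<Union>C \<in> ?\<A>" using sub by blast
  qed
  then obtain M where M': "M \<in> ?\<A>" and max: "\<forall>X\<in>?\<A>. M \<subseteq> X \<longrightarrow> X = M" by (rule bexE)
  have M: "M \<subseteq> ?X" "indep_over (U J) M" using M' by simp_all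
  have MP: "M \<subseteq> carrier P" using M U_closed by blast
  note sub = rsubmodule_span_over[OF rsubmodule_U[of J] MP]
  have X: "w \<in> span_over (U J) M" if w: "w \<in> ?X" for w
  proof (cases "w \<in> M")
    case True
    then show ?thesis using gen_in_span_over[OF rsubmodule_U MP] by blast
  next
    case False
    let ?M = "insert w M"
    have M': "?M \<subseteq> carrier P" using MP w U_closed by blast
    have "\<not> indep_over (U J) ?M" using bspec[OF max, of ?M] M w False by auto
    then obtain c where c: "c \<in> coefs A ?M" "lc c \<in> U J" "c \<noteq> (\<lambda>_. \<zero>\<^bsub>A\<^esub>)"
      by (auto simp: indep_over_def)
    let ?S = "{b. c b \<noteq> \<zero>\<^bsub>A\<^esub>}"
    have S: "finite ?S" "?S \<subseteq> ?M" using c by (auto simp: coefs_iff)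
    have "\<Phi> b i \<in> A_gr 0" if b: "b \<in> ?S" and i: "i \<in> J' - J" for b i
    proof (cases "\<Phi> b i = \<zero>\<^bsub>A\<^esub>")
      case True
      then show ?thesis using AD.D_zero by simp
    next
      case False
      have "b \<in> P_gr n" "i \<in> I" using b i S M w J by (auto simp: closed_idx_def)
      then show ?thesis using \<Phi>_deg[of b n i] False deg[OF i] by simp
    qed
    \<comment> \<open>All elements lie in \<open>U J'\<close>, so a combination lies in
      \<open>U J\<close> exactly when its coordinates on \<open>J' - J\<close> vanish. These are
      linear equations over \<open>A_gr 0\<close>, and \<open>c\<close> solves them over
      \<open>A\<close>.\<close>
    then have "\<exists>l. (\<forall>b\<in>?S. l b \<in> A_gr 0) \<and> (\<exists>b\<in>?S. l b \<noteq> \<zero>\<^bsub>A\<^esub>) \<and>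
        (\<forall>i\<in>J' - J. (\<Oplus>\<^bsub>A\<^esub>b\<in>?S. \<Phi> b i \<otimes>\<^bsub>A\<^esub> l b) = \<zero>\<^bsub>A\<^esub>)"
      using c S(1) \<Phi>_lc[OF coefs_mono[OF M' c(1)]]
      by (intro A0_dependence[where a = c]) (auto simp: coefs_iff U_def)
    then obtain l where l: "\<And>b. b \<in> ?S \<Longrightarrow> l b \<in> A_gr 0" "\<exists>b\<in>?S. l b \<noteq> \<zero>\<^bsub>A\<^esub>"
      "\<And>i. i \<in> J' - J \<Longrightarrow> (\<Oplus>\<^bsub>A\<^esub>b\<in>?S. \<Phi> b i \<otimes>\<^bsub>A\<^esub> l b) = \<zero>\<^bsub>A\<^esub>" by blast
    define e where "e b = (if b \<in> ?S then l b else \<zero>\<^bsub>A\<^esub>)" for b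
    have e0: "e b \<in> A_gr 0" for b using l(1) AD.D_zero by (auto simp: e_def)
    have e: "e \<in> coefs A ?M"
      using e0[THEN AD.D_closed] S by (auto simp: coefs_iff e_def elim: rev_finite_subset)
    have "lc e \<in> U J"
    proof -
      have "lc e \<in> U J'"
        by (rule rsubmodule_lc[OF rsubmodule_U coefs_mono[OF M' e]])
          (use S M w in \<open>auto simp: e_def split: if_splits\<close>)
      moreover have "\<Phi> (lc e) i = \<zero>\<^bsub>A\<^esub>" if i: "i \<in> J' - J" for i
      proof -
        have "\<Phi> (lc e) i = (\<Oplus>\<^bsub>A\<^esub>b\<in>{b. e b \<noteq> \<zero>\<^bsub>A\<^esub>}. \<Phi> b i \<otimes>\<^bsub>A\<^esub> e b)"
          by (rule \<Phi>_lc[OF coefs_mono[OF M' e]])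
        also have "\<dots> = (\<Oplus>\<^bsub>A\<^esub>b\<in>?S. \<Phi> b i \<otimes>\<^bsub>A\<^esub> l b)"
        proof (rule A.add.finprod_mono_neutral_cong_left)
          have cl: "\<Phi> b i \<in> carrier A" "l b \<in> carrier A" if "b \<in> ?S" for b
            using that S(2) M' \<Phi>_closed l(1)[THEN AD.D_closed] by blast+
          then show "(\<lambda>b. \<Phi> b i \<otimes>\<^bsub>A\<^esub> l b) \<in> ?S \<rightarrow> carrier A" by auto
          show "\<Phi> b i \<otimes>\<^bsub>A\<^esub> l b = \<zero>\<^bsub>A\<^esub>" if "b \<in> ?S - {b. e b \<noteq> \<zero>\<^bsub>A\<^esub>}" for b
            using cl that by (auto simp: e_def)
        qed (use S in \<open>auto simp: e_def\<close>)
        finally show ?thesis using l(3)[OF i] by simp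
      qed
      ultimately show ?thesis by (auto simp: U_def)
    qed
    \<comment> \<open>Were this coefficient zero, \<open>e\<close> would be a nontrivial relation on
      \<open>M\<close> alone. Being nonzero of degree zero it is invertible, so the relation can be
      solved for \<open>w\<close>.\<close>
    have "e w \<noteq> \<zero>\<^bsub>A\<^esub>"
    proof
      assume "e w = \<zero>\<^bsub>A\<^esub>"
      then have "e \<in> coefs A M" using e by (auto simp: coefs_iff)
      then have "e = (\<lambda>_. \<zero>\<^bsub>A\<^esub>)" using M(2) \<open>lc e \<in> U J\<close> by (auto simp: indep_over_def)
      moreover obtain b where "b \<in> ?S" "l b \<noteq> \<zero>\<^bsub>A\<^esub>" using l(2) by blast
      ultimately show False by (auto simp: e_def dest: fun_cong[of _ _ b])
    qed
    then obtain m where m: "m \<in> A_gr 0" "e w \<otimes>\<^bsub>A\<^esub> m = \<one>\<^bsub>A\<^esub>" using A0_inverse[OF e0] by blast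
    have mA: "m \<in> carrier A" using m AD.D_closed by blast
    let ?f = "\<lambda>b. e b \<otimes>\<^bsub>A\<^esub> m"
    have f: "?f \<in> coefs A ?M" by (rule coefs_ract[OF e mA])
    have fU: "lc ?f \<in> U J"
      using lc_ract[OF coefs_mono[OF M' e] mA] rsubmodule_ract[OF rsubmodule_U \<open>lc e \<in> U J\<close> mA] by simp
    let ?g = "\<lambda>b. if b \<in> M then ?f b else \<zero>\<^bsub>A\<^esub>" and ?h = "\<lambda>b. if b = w then \<one>\<^bsub>A\<^esub> else \<zero>\<^bsub>A\<^esub>"
    have g: "?g \<in> coefs A M" by (rule coefs_restrict[OF f])
    have h: "?h \<in> coefs A (carrier P)" by (rule coefs_single) (use M' in auto)
    have "?f = (\<lambda>b. ?g b \<oplus>\<^bsub>A\<^esub> ?h b)"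
      using f m False by (auto simp: coefs_iff fun_eq_iff)
    then have "lc ?f = lc ?g \<oplus>\<^bsub>P\<^esub> lc ?h" using lc_add[OF coefs_mono[OF MP g] h] by simp
    then have "lc ?f = lc ?g \<oplus>\<^bsub>P\<^esub> w" using lc_single[of w "\<one>\<^bsub>A\<^esub>"] M' by simp
    moreover have "lc ?f \<in> span_over (U J) M"
      using fU base_in_span_over[OF rsubmodule_U MP] by blast
    moreover have "lc ?g \<in> span_over (U J) M" by (rule span_over_lc[OF rsubmodule_U MP g])
    moreover have "w \<in> carrier P" using M' by simp
    ultimately show ?thesis using rsubmodule_add_cancel[OF sub, of "lc ?g" w] by metis
  qed
  have "J' \<subseteq> span_over (U J) M"
  proof
    fix i assume i: "i \<in> J'"
    note base = base_in_span_over[OF rsubmodule_U MP, of J]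
    show "i \<in> span_over (U J) M"
    proof (cases "i \<in> J")
      case True
      then show ?thesis using J(1) base by (auto simp: closed_idx_def)
    next
      case False
      then obtain u w where "u \<in> U J" "w \<in> ?X" "i = u \<oplus>\<^bsub>P\<^esub> w" using W i by blast
      then show ?thesis using base X rsubmodule_add[OF sub] by blast
    qed
  qed
  then have "relbasis (U J) (U J') M" using M U_least[OF sub] by (auto simp: relbasis_def)
  then show ?thesis using M(1) by blast
qed

section \<open>Transfinite extension\<close>

lemma relbasis_U_trans:
  assumes "J0 \<subseteq> J1" "J1 \<subseteq> J2" "relbasis (U J0) (U J1) B1" "relbasis (U J1) (U J2) B2"
  shows "relbasis (U J0) (U J2) (B1 \<union> B2)"
  using assms by (intro relbasis_trans[of _ "U J1"] rsubmodule_U U_mono)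

text \<open>Zorn's lemma applies to pairs of an index set and a basis over \<open>U J0\<close>:
  spanning and independence pass to unions of chains, and a maximal pair with index set short of
  \<open>J'\<close> could be enlarged. The parameter \<open>W\<close> lets the same argument serve
  the bounded case and the final one.\<close>

lemma relbasis_exhaust:
  assumes J0: "closed_idx J0" "J0 \<subseteq> J'"
    and step: "\<And>J. closed_idx J \<Longrightarrow> J0 \<subseteq> J \<Longrightarrow> J \<subset> J' \<Longrightarrow>
      \<exists>J1 B. closed_idx J1 \<and> J \<subset> J1 \<and> J1 \<subseteq> J' \<and> B \<subseteq> W \<and> relbasis (U J) (U J1) B"
  shows "\<exists>B\<subseteq>W. relbasis (U J0) (U J') B"
proof -
  \<comment> \<open>A pair \<open>(J, B)\<close> is encoded as the disjoint union of \<open>J\<close> and \<open>B\<close>, so that pairs are ordered by inclusion.\<close>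
  define idx where "idx Z = {x. (True, x) \<in> Z}" for Z :: "(bool \<times> 'p) set"
  define bas where "bas Z = {x. (False, x) \<in> Z}" for Z :: "(bool \<times> 'p) set"
  define enc where "enc J B = Pair True ` J \<union> Pair False ` B" for J B :: "'p set"
  have enc: "idx (enc J B) = J" "bas (enc J B) = B" for J B
    by (auto simp: idx_def bas_def enc_def)
  define \<A> where "\<A> = {Z. closed_idx (idx Z) \<and> J0 \<subseteq> idx Z \<and> idx Z \<subseteq> J' \<and> bas Z \<subseteq> W \<and>
    relbasis (U J0) (U (idx Z)) (bas Z)}"
  have \<A>D: "closed_idx (idx Z)" "J0 \<subseteq> idx Z" "idx Z \<subseteq> J'" "bas Z \<subseteq> W"
      "relbasis (U J0) (U (idx Z)) (bas Z)" if "Z \<in> \<A>" for Z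
    using that by (auto simp: \<A>_def)
  have "\<exists>M\<in>\<A>. \<forall>X\<in>\<A>. M \<subseteq> X \<longrightarrow> X = M"
  proof (rule subset_Zorn_nonempty)
    have "enc J0 {} \<in> \<A>" using J0 relbasis_refl[OF rsubmodule_U] by (simp add: \<A>_def enc)
    then show "\<A> \<noteq> {}" by blast
  next
    fix C assume C: "C \<noteq> {}" "subset.chain \<A> C"
    then have CA: "C \<subseteq> \<A>" by (auto simp: subset_chain_def)
    have idxU: "idx (\<Union>C) = (\<Union>Z\<in>C. idx Z)" and basU: "bas (\<Union>C) = (\<Union>Z\<in>C. bas Z)"
      by (auto simp: idx_def bas_def)
    have Umono: "U (idx Z) \<subseteq> U (idx (\<Union>C))" if "Z \<in> C" for Z
      using that by (intro U_mono) (auto simp: idxU)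
    have basis_in: "bas (\<Union>C) \<subseteq> U (idx (\<Union>C))"
      using Umono \<A>D(5) CA unfolding basU relbasis_def by blast
    then have "bas (\<Union>C) \<subseteq> carrier P" using U_closed by blast
    note sub = rsubmodule_span_over[OF rsubmodule_U[of J0] this]
    have "idx (\<Union>C) \<subseteq> span_over (U J0) (bas (\<Union>C))"
    proof
      fix j assume "j \<in> idx (\<Union>C)"
      then obtain Z where Z: "Z \<in> C" "j \<in> idx Z" by (auto simp: idxU)
      then have "j \<in> span_over (U J0) (bas Z)"
        using \<A>D(1,5)[of Z] CA by (auto simp: closed_idx_def relbasis_def)
      moreover have "bas Z \<subseteq> bas (\<Union>C)" using Z by (auto simp: basU)
      ultimately show "j \<in> span_over (U J0) (bas (\<Union>C))"
        using span_over_mono[of "U J0" "U J0"] by blast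
    qed
    then have "U (idx (\<Union>C)) \<subseteq> span_over (U J0) (bas (\<Union>C))" by (rule U_least[OF sub])
    moreover have "indep_over (U J0) (bas (\<Union>C))"
    proof (rule indep_over_directed)
      fix S assume S: "finite S" "S \<subseteq> bas (\<Union>C)"
      \<comment> \<open>Tagging turns a finite set of basis elements into a finite subset of the
        union, which lies in a single member of the chain.\<close>
      then have "finite (Pair False ` S)" "Pair False ` S \<subseteq> \<Union>C" by (auto simp: bas_def)
      then obtain Z where Z: "Z \<in> C" "Pair False ` S \<subseteq> Z"
        by (rule finite_subset_Union_chain[OF _ _ C])
      then show "\<exists>B'. S \<subseteq> B' \<and> indep_over (U J0) B'"
        using \<A>D(5)[of Z] CA by (intro exI[of _ "bas Z"]) (auto simp: bas_def relbasis_def)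
    qed
    ultimately have "relbasis (U J0) (U (idx (\<Union>C))) (bas (\<Union>C))"
      using basis_in by (simp add: relbasis_def)
    moreover have "closed_idx (idx (\<Union>C))"
      using \<A>D(1) CA Umono unfolding closed_idx_def idxU by blast
    moreover have "J0 \<subseteq> idx (\<Union>C)" using C(1) \<A>D(2) CA by (auto simp: idxU)
    moreover have "idx (\<Union>C) \<subseteq> J'" "bas (\<Union>C) \<subseteq> W" using \<A>D(3,4) CA by (auto simp: idxU basU)
    ultimately show "\<Union>C \<in> \<A>" by (simp add: \<A>_def)
  qed
  then obtain M where M: "M \<in> \<A>" and max: "\<forall>X\<in>\<A>. M \<subseteq> X \<longrightarrow> X = M" by (rule bexE)
  note MD = \<A>D[OF M]
  have "idx M = J'"
  proof (rule ccontr)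
    assume "idx M \<noteq> J'"
    then obtain J1 B where J1: "closed_idx J1" "idx M \<subset> J1" "J1 \<subseteq> J'" "B \<subseteq> W"
        "relbasis (U (idx M)) (U J1) B"
      using step[OF MD(1,2)] MD(3) by blast
    have "relbasis (U J0) (U J1) (bas M \<union> B)"
      by (rule relbasis_U_trans[OF MD(2) _ MD(5) J1(5)]) (use J1 in auto)
    then have "enc J1 (bas M \<union> B) \<in> \<A>" using J1 MD by (auto simp: \<A>_def enc)
    moreover have "M \<subseteq> enc J1 (bas M \<union> B)"
    proof
      fix z assume "z \<in> M"
      then show "z \<in> enc J1 (bas M \<union> B)"
        using J1(2) by (cases z; cases "fst z") (auto simp: enc_def idx_def bas_def)
    qed
    ultimately have "enc J1 (bas M \<union> B) = M" using max by blast
    then show False using J1(2) enc(1)[of J1 "bas M \<union> B"] by auto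
  qed
  then show ?thesis using MD by blast
qed

text \<open>The bound provides a new index of least degree at every stage, and all new indices of
  that degree are added together. Subtracting from each of them its truncation to the fixed set
  \<open>T\<close> changes it only by an element of \<open>U T\<close> and puts the basis into
  \<open>kernel T\<close>.\<close>

lemma relbasis_bounded_below:
  assumes J: "closed_idx J" "closed_idx J'" "J \<subseteq> J'" and T: "closed_idx T" "T \<subseteq> J"
    and bound: "\<And>i. i \<in> J' - J \<Longrightarrow> m \<le> deg i"
  shows "\<exists>B\<subseteq>kernel T \<inter> (\<Union>d. P_gr d). relbasis (U J) (U J') B"
proof (rule relbasis_exhaust[OF J(1,3)])
  fix J1 assume J1: "closed_idx J1" "J \<subseteq> J1" "J1 \<subset> J'"
  then obtain i0 where "i0 \<in> J' - J1" by blast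
  \<comment> \<open>Degrees are measured from \<open>m\<close>, so the minimum is taken over natural
    numbers.\<close>
  from ex_has_least_nat[of "\<lambda>i. i \<in> J' - J1" i0 "\<lambda>i. nat (deg i - m)", OF this]
  obtain k where k: "k \<in> J' - J1" "\<And>i. i \<in> J' - J1 \<Longrightarrow> nat (deg k - m) \<le> nat (deg i - m)"
    by blast
  have least: "deg k \<le> deg i" if "i \<in> J' - J1" for i
  proof -
    have "m \<le> deg i" "m \<le> deg k" using bound that k(1) J1(2) by auto
    then show ?thesis using k(2)[OF that] by linarith
  qed
  define J2 where "J2 = J1 \<union> {i \<in> J' - J1. deg i = deg k}"
  have J2: "closed_idx J2"
  proof (rule closed_idxI)
    show "J2 \<subseteq> I" using J1 J by (auto simp: J2_def closed_idx_def)
    fix j i assume j: "j \<in> J2" and nz: "\<Phi> j i \<noteq> \<zero>\<^bsub>A\<^esub>"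
    show "i \<in> J2"
    proof (cases "j \<in> J1 \<or> i \<in> J1")
      case True
      then show ?thesis using closed_idxD[OF J1(1) _ nz] by (auto simp: J2_def)
    next
      case False
      then have j': "j \<in> J'" "deg j = deg k" using j by (auto simp: J2_def)
      have i: "i \<in> J' - J1" using closed_idxD[OF J(2) j'(1) nz] False by blast
      \<comment> \<open>The degree of \<open>j\<close> is least among the new indices, so a new
        index occurring in \<open>j\<close> has the same degree.\<close>
      moreover have "deg i \<le> deg j"
        using \<Phi>_deg[OF I_deg _ nz] j' i J by (auto simp: closed_idx_def)
      ultimately show ?thesis using least[OF i] j' by (auto simp: J2_def)
    qed
  qed
  have "\<exists>B\<subseteq>kernel T \<inter> P_gr (deg k). relbasis (U J1) (U J2) B"
  proof (rule relbasis_single_degree[OF J1(1) J2])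
    fix i assume i: "i \<in> J2 - J1"
    let ?w = "i \<oplus>\<^bsub>P\<^esub> \<ominus>\<^bsub>P\<^esub> \<rho> T i"
    have iI: "i \<in> I" and iU: "i \<in> U J2" and di: "deg i = deg k"
      using i J2 by (auto simp: closed_idx_def) (auto simp: J2_def)
    have iP: "i \<in> carrier P" "\<rho> T i \<in> carrier P" using iI I_closed \<rho>_closed by auto
    have \<rho>U: "\<rho> T i \<in> U T" by (rule \<rho>_in_U[OF T(1) iP(1)])
    have sub: "T \<subseteq> J1" "T \<subseteq> J2" using T J1 by (auto simp: J2_def)
    have "?w \<in> P_gr (deg k)"
      using I_deg[OF iI] di by (intro PD.D_add PD.D_minus \<rho>_homogeneous) auto
    moreover have "?w \<in> U J2"
      using iU \<rho>U U_mono[OF sub(2)] by (intro rsubmodule_add rsubmodule_minus rsubmodule_U) auto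
    moreover have "?w \<in> kernel T" by (rule minus_\<rho>_in_kernel[OF T(1) iP(1)])
    moreover have "i = \<rho> T i \<oplus>\<^bsub>P\<^esub> ?w"
      using iP P.r_neg2[of "\<rho> T i" i] by (simp add: P.a_comm P.a_lcomm P.a_assoc P.r_neg)
    ultimately show "\<exists>u\<in>U J1. \<exists>w\<in>kernel T \<inter> P_gr (deg k) \<inter> U J2. i = u \<oplus>\<^bsub>P\<^esub> w"
      using \<rho>U U_mono[OF sub(1)] by blast
  qed (auto simp: J2_def)
  then obtain B where "B \<subseteq> kernel T \<inter> P_gr (deg k)" "relbasis (U J1) (U J2) B" by (elim exE conjE)
  moreover have "J1 \<subset> J2" "J2 \<subseteq> J'" using k(1) J1 by (auto simp: J2_def)
  ultimately show "\<exists>J2 B. closed_idx J2 \<and> J1 \<subset> J2 \<and> J2 \<subseteq> J' \<and>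
      B \<subseteq> kernel T \<inter> (\<Union>d. P_gr d) \<and> relbasis (U J1) (U J2) B"
    using J2 by (intro exI[of _ J2] exI[of _ B]) auto
qed

text \<open>An element of \<open>U T\<close> is absorbed by shrinking \<open>T\<close>: the indices
  outside \<open>J\<close> of degree at least \<open>n\<close> are removed, where \<open>n\<close>
  bounds from below all degrees occurring in \<open>y\<close>. The removed degrees are bounded
  below, so the quotient has a basis, which can be taken inside \<open>kernel T'\<close>.\<close>

lemma relbasis_absorbing:
  assumes J: "closed_idx J" and T: "closed_idx T" "J \<subseteq> T" and y: "y \<in> U T"
  shows "\<exists>T' B. closed_idx T' \<and> J \<subseteq> T' \<and> T' \<subseteq> T \<and> B \<subseteq> (\<Union>d. P_gr d) \<and>
    relbasis (U T') (U T) B \<and> y \<in> span_over (U J) B"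
proof -
  have yP: "y \<in> carrier P" using y U_closed by blast
  \<comment> \<open>Inserting zero makes the minimum defined when \<open>y\<close> has no nonzero
    coordinate; only the lower bound matters.\<close>
  define n where "n = Min (insert 0 (deg ` {i. \<Phi> y i \<noteq> \<zero>\<^bsub>A\<^esub>}))"
  have n: "n \<le> deg i" if "\<Phi> y i \<noteq> \<zero>\<^bsub>A\<^esub>" for i
    unfolding n_def using \<Phi>_finite[OF yP] that by (intro Min_le) auto
  define T' where "T' = J \<union> {i \<in> T. deg i < n}"
  have T': "closed_idx T'" "J \<subseteq> T'" "T' \<subseteq> T"
    using closed_idx_Un[OF J closed_idx_deg_less[OF T(1)]] T by (auto simp: T'_def)
  obtain B where B: "B \<subseteq> kernel T' \<inter> (\<Union>d. P_gr d)" "relbasis (U T') (U T) B"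
    using relbasis_bounded_below[OF T'(1) T(1) T'(3) T'(1) subset_refl, of n] T'_def by fastforce
  obtain u c where uc: "y = u \<oplus>\<^bsub>P\<^esub> lc c" "u \<in> U T'" "c \<in> coefs A B"
    using B(2) y by (auto simp: relbasis_def span_over_def)
  have BP: "B \<subseteq> carrier P" using B(1) by (auto simp: kernel_def)
  \<comment> \<open>Since \<open>B\<close> lies in the kernel of \<open>\<rho> T'\<close>, the remainder \<open>u\<close> is \<open>\<rho> T' y\<close>, which involves only elements of \<open>J\<close>.\<close>
  have "lc c \<in> kernel T'"
    by (rule rsubmodule_lc[OF rsubmodule_kernel coefs_mono[OF BP uc(3)]])
      (use uc(3) B(1) in \<open>auto simp: coefs_iff\<close>)
  then have "\<rho> T' y = u"
    using uc(1) \<rho>_id[OF uc(2)] \<rho>_add[of u "lc c" T'] rsubmodule_closed[OF rsubmodule_U uc(2)]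
    by (auto simp: kernel_def)
  moreover have "\<rho> T' y \<in> U J"
  proof (rule \<rho>_in[OF rsubmodule_U yP])
    fix i assume "i \<in> T'" "\<Phi> y i \<noteq> \<zero>\<^bsub>A\<^esub>"
    then show "i \<in> U J" using n[of i] J by (auto simp: T'_def closed_idx_def)
  qed
  ultimately have "y \<in> span_over (U J) B" using uc by (simp add: span_overI)
  then show ?thesis using T' B by blast
qed

text \<open>The basis is built from the top down: starting from \<open>J'\<close> with the empty
  basis, each stage shrinks \<open>T\<close>, enlarges \<open>B\<close> and brings one more element
  of \<open>J' - J\<close> into the span over \<open>U J\<close>. The sets \<open>T\<close> need not
  shrink to \<open>J\<close>: spanning comes from the absorbed elements, and independence over
  \<open>U J\<close> from \<open>J \<subseteq> T\<close> at every stage.\<close>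

lemma relbasis_countable:
  assumes J: "closed_idx J" "closed_idx J'" "J \<subseteq> J'" and count: "countable (J' - J)"
  shows "\<exists>B\<subseteq>\<Union>d. P_gr d. relbasis (U J) (U J') B"
proof (cases "J' = J")
  case True
  then show ?thesis using relbasis_refl[OF rsubmodule_U] by blast
next
  case False
  then have ne: "J' - J \<noteq> {}" using J(3) by blast
  \<comment> \<open>An enumeration, with repetitions if the difference is finite.\<close>
  define x where "x = from_nat_into (J' - J)"
  have x: "x n \<in> J' - J" for n unfolding x_def by (rule from_nat_into[OF ne])
  have x_surj: "\<exists>n. i = x n" if "i \<in> J' - J" for i
    using from_nat_into_surj[OF count that] by (auto simp: x_def)
  define ok where "ok s \<longleftrightarrow> closed_idx (fst s) \<and> J \<subseteq> fst s \<and> fst s \<subseteq> J' \<and>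
    snd s \<subseteq> (\<Union>d. P_gr d) \<and> relbasis (U (fst s)) (U J') (snd s)" for s :: "'p set \<times> 'p set"
  have "\<exists>f. \<forall>n. ok (f n) \<and> (snd (f n) \<subseteq> snd (f (Suc n)) \<and> x n \<in> span_over (U J) (snd (f (Suc n))))"
  proof (rule dependent_nat_choice)
    show "\<exists>s. ok s" using J relbasis_refl[OF rsubmodule_U, of J'] by (intro exI[of _ "(J', {})"]) (auto simp: ok_def)
  next
    fix s n assume "ok s"
    then obtain T B where s: "s = (T, B)" and T: "closed_idx T" "J \<subseteq> T" "T \<subseteq> J'"
      and B: "B \<subseteq> (\<Union>d. P_gr d)" "relbasis (U T) (U J') B" by (cases s) (auto simp: ok_def)
    have "x n \<in> U J'" using x J(2) by (auto simp: closed_idx_def)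
    \<comment> \<open>Only the remainder \<open>y\<close> of \<open>x n\<close> modulo the present
      basis has to be absorbed.\<close>
    then obtain y c where yc: "x n = y \<oplus>\<^bsub>P\<^esub> lc c" "y \<in> U T" "c \<in> coefs A B"
      using B(2) by (auto simp: relbasis_def span_over_def)
    obtain T' B' where T': "closed_idx T'" "J \<subseteq> T'" "T' \<subseteq> T" and B': "B' \<subseteq> (\<Union>d. P_gr d)"
        "relbasis (U T') (U T) B'" and y: "y \<in> span_over (U J) B'"
      using relbasis_absorbing[OF J(1) T(1,2) yc(2)] by blast
    have "relbasis (U T') (U J') (B' \<union> B)" by (rule relbasis_U_trans[OF T'(3) T(3) B'(2) B(2)])
    then have ok': "ok (T', B' \<union> B)" using T' T B B' by (auto simp: ok_def)
    have BP: "B' \<union> B \<subseteq> carrier P" using B(1) B'(1) PD.D_closed by blast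
    note sub = rsubmodule_span_over[OF rsubmodule_U[of J] BP]
    have "y \<in> span_over (U J) (B' \<union> B)" using y span_over_mono[of "U J" "U J" B'] by blast
    moreover have "lc c \<in> span_over (U J) (B' \<union> B)"
      using coefs_mono[OF _ yc(3), of "B' \<union> B"] by (intro span_over_lc[OF rsubmodule_U BP]) auto
    ultimately have "x n \<in> span_over (U J) (B' \<union> B)" using yc(1) rsubmodule_add[OF sub] by simp
    then show "\<exists>s'. ok s' \<and> (snd s \<subseteq> snd s' \<and> x n \<in> span_over (U J) (snd s'))"
      using ok' s by (intro exI[of _ "(T', B' \<union> B)"]) auto
  qed
  then obtain f where f: "\<And>n. ok (f n)" "\<And>n. snd (f n) \<subseteq> snd (f (Suc n))"
      "\<And>n. x n \<in> span_over (U J) (snd (f (Suc n)))" by blast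
  define B where "B = (\<Union>n. snd (f n))"
  have BH: "B \<subseteq> (\<Union>d. P_gr d)" and BU: "B \<subseteq> U J'"
    using f(1) unfolding B_def ok_def relbasis_def by blast+
  have BP: "B \<subseteq> carrier P" using BU U_closed by blast
  have "J' \<subseteq> span_over (U J) B"
  proof
    fix i assume i: "i \<in> J'"
    show "i \<in> span_over (U J) B"
    proof (cases "i \<in> J")
      case True
      then show ?thesis using base_in_span_over[OF rsubmodule_U BP] J(1) by (auto simp: closed_idx_def)
    next
      case False
      then obtain n where "i = x n" using x_surj i by blast
      moreover have "span_over (U J) (snd (f (Suc n))) \<subseteq> span_over (U J) B"
        by (rule span_over_mono) (auto simp: B_def)
      ultimately show ?thesis using f(3) by blast
    qed
  qed
  then have "U J' \<subseteq> span_over (U J) B" by (rule U_least[OF rsubmodule_span_over[OF rsubmodule_U BP]])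
  moreover have "indep_over (U J) B"
  proof (rule indep_over_directed)
    fix S assume S: "finite S" "S \<subseteq> B"
    have mono: "snd (f m) \<subseteq> snd (f n)" if "m \<le> n" for m n
      using that by (rule lift_Suc_mono_le[of "\<lambda>n. snd (f n)", OF f(2)])
    have "\<exists>n. S \<subseteq> snd (f n)"
      using S
    proof (induction S rule: finite_induct)
      case (insert b S)
      then obtain m n where "S \<subseteq> snd (f m)" "b \<in> snd (f n)" by (auto simp: B_def)
      then have "insert b S \<subseteq> snd (f (max m n))" using mono[of m "max m n"] mono[of n "max m n"] by auto
      then show ?case by blast
    qed simp
    then obtain n where n: "S \<subseteq> snd (f n)" by blast
    have "U J \<subseteq> U (fst (f n))" "indep_over (U (fst (f n))) (snd (f n))"
      using f(1)[of n] U_mono by (auto simp: ok_def relbasis_def)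
    \<comment> \<open>Independence modulo the larger submodule \<open>U (fst (f n))\<close> is the
      stronger statement.\<close>
    then have "indep_over (U J) (snd (f n))" by (auto simp: indep_over_def)
    then show "\<exists>B'. S \<subseteq> B' \<and> indep_over (U J) B'" using n by blast
  qed
  ultimately show ?thesis using BH BU by (auto simp: relbasis_def)
qed

text \<open>Each element has finitely many nonzero coordinates, so following coordinates repeatedly
  from \<open>i\<close> reaches only countably many indices.\<close>

lemma countable_closure:
  assumes "i \<in> I"
  shows "\<exists>C. closed_idx C \<and> i \<in> C \<and> countable C"
proof -
  define R where "R = {(j, k). j \<in> I \<and> \<Phi> j k \<noteq> \<zero>\<^bsub>A\<^esub>}"
  have R: "k \<in> I" if "(j, k) \<in> R" for j k using that \<Phi>_outside I_closed by (auto simp: R_def)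
  let ?C = "R\<^sup>* `` {i}"
  have C: "?C \<subseteq> I"
  proof
    fix j assume "j \<in> ?C"
    then have "(i, j) \<in> R\<^sup>*" by simp
    then show "j \<in> I" by (induction rule: rtrancl_induct) (use assms R in auto)
  qed
  have "closed_idx ?C"
    using C by (intro closed_idxI) (auto simp: R_def intro: rtrancl_into_rtrancl)
  moreover have "countable ?C"
  proof (rule countable_rtrancl)
    fix Y :: "'p set" assume Y: "countable Y"
    have "R `` Y = (\<Union>j\<in>Y \<inter> I. {k. \<Phi> j k \<noteq> \<zero>\<^bsub>A\<^esub>})" by (auto simp: R_def)
    also have "countable \<dots>"
    proof (rule countable_UN)
      show "countable (Y \<inter> I)" using Y by (rule countable_subset[rotated]) simp
      show "countable {k. \<Phi> j k \<noteq> \<zero>\<^bsub>A\<^esub>}" if "j \<in> Y \<inter> I" for j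
        using that \<Phi>_finite I_closed by (intro countable_finite) auto
    qed
    finally show "countable (R `` Y)" .
  qed simp
  ultimately show ?thesis by blast
qed

text \<open>Starting from the empty set, any missing index can be added together with a countable
  closed set containing it. As \<open>U {}\<close> is zero and \<open>U I\<close> is the whole
  module, the resulting relative basis is a free basis.\<close>

lemma ex_homogeneous_basis: "\<exists>B\<subseteq>\<Union>d. P_gr d. free_basis A P B"
proof -
  have "\<exists>B\<subseteq>\<Union>d. P_gr d. relbasis (U {}) (U I) B"
  proof (rule relbasis_exhaust)
    show "closed_idx {}" by (simp add: closed_idx_def)
  next
    fix J assume J: "closed_idx J" "{} \<subseteq> J" "J \<subset> I"
    then obtain i where i: "i \<in> I" "i \<notin> J" by blast
    obtain C where C: "closed_idx C" "i \<in> C" "countable C" using countable_closure[OF i(1)] by blast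
    have JC: "closed_idx (J \<union> C)" by (rule closed_idx_Un[OF J(1) C(1)])
    have "\<exists>B\<subseteq>\<Union>d. P_gr d. relbasis (U J) (U (J \<union> C)) B"
      by (rule relbasis_countable[OF J(1) JC]) (use C(3) in \<open>auto intro: countable_subset[of _ C]\<close>)
    moreover have "J \<subset> J \<union> C" "J \<union> C \<subseteq> I" using i C JC by (auto simp: closed_idx_def)
    ultimately show "\<exists>J1 B. closed_idx J1 \<and> J \<subset> J1 \<and> J1 \<subseteq> I \<and> B \<subseteq> (\<Union>d. P_gr d) \<and>
        relbasis (U J) (U J1) B"
      using JC by blast
  qed simp
  then show ?thesis using free_basis_if_relbasis by (auto simp: U_empty U_I)
qed

end

theorem theoremA1:
  fixes K :: "'k ring" and A :: "('k, 'a) module" and A_gr :: "nat \<Rightarrow> 'a set"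
    and P :: "('a, 'p) rmodule" and P_gr :: "int \<Rightarrow> 'p set"
  assumes "connected_graded_algebra K A A_gr"
    and "graded_right_module A A_gr P P_gr"
    and "projective A P"
  shows "\<exists>B. B \<subseteq> (\<Union>i. P_gr i) \<and> free_basis A P B"
proof -
  interpret graded_module_over_connected K A A_gr P P_gr
    using assms(1,2) by (simp add: graded_module_over_connected_def)
  obtain I deg \<Phi> where "graded_splitting K A A_gr P P_gr I deg \<Phi>"
    using ex_graded_splitting[OF assms(3)] by blast
  then interpret graded_splitting K A A_gr P P_gr I deg \<Phi> .
  show ?thesis by (rule ex_homogeneous_basis)
qed

end
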